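(* Given two explicitly known distributions $q_1,q_2$ on $[n]$ and $\epsilon>0$, there is an identity tester in the presence of known noise that uses $O(\sqrt n/\epsilon^2)$ samples. That is, there is a randomized algorithm that draws $O(\sqrt n/\epsilon^2)$ independent samples from an unknown distribution $p$ on $[n]$ and satisfies: if $p=(1-\alpha)q_1+\alpha q_2$ for some $\alpha\in[0,1]$, it outputs accept with probability at least $2/3$; if $\|p-((1-\alpha)q_1+\alpha q_2)\|_1\ge\epsilon$ for every $\alpha\in[0,1]$, it outputs reject with probability at least $2/3$. Furthermore, $\Omega(\sqrt n/\epsilon^2)$ samples are required for this task (in the worst case over $q_1,q_2$).
   Context: $[n]=\{1,\dots,n\}$. A distribution is explicitly known if the algorithm knows the probability of every domain element under it. The distribution $p$ is accessed only through independent samples, and the mixture parameter $\alpha$ is not given to the algorithm. An identity tester in the presence of known noise is an algorithm with the two stated accept/reject guarantees. *)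

theory Defs
  imports "HOL-Probability.Probability"
begin

definition dist_on :: "nat \<Rightarrow> nat pmf \<Rightarrow> bool" where
  "dist_on n p \<longleftrightarrow> set_pmf p \<subseteq> {1..n}"

definition noisy_mixture :: "real \<Rightarrow> nat pmf \<Rightarrow> nat pmf \<Rightarrow> nat \<Rightarrow> real" where
  "noisy_mixture \<alpha> q1 q2 = (\<lambda>i. (1 - \<alpha>) * pmf q1 i + \<alpha> * pmf q2 i)"

definition l1_dist :: "nat \<Rightarrow> (nat \<Rightarrow> real) \<Rightarrow> (nat \<Rightarrow> real) \<Rightarrow> real" where
  "l1_dist n f g = (\<Sum>i=1..n. \<bar>f i - g i\<bar>)"

datatype verdict = Accept | Reject

(* A randomized algorithm maps the list of observed samples to a distribution over verdicts,
   which accounts for its internal randomness. It has no other access to p. An algorithm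
   drawing at most m samples can be viewed as one drawing exactly m and ignoring some. *)
type_synonym sample_algorithm = "nat list \<Rightarrow> verdict pmf"

definition run_on_samples :: "sample_algorithm \<Rightarrow> nat \<Rightarrow> nat pmf \<Rightarrow> verdict pmf" where
  "run_on_samples A m p = bind_pmf (replicate_pmf m p) A"

(* The algorithm A is fixed before p and alpha: it may depend on n, q1, q2, \<epsilon> only. *)
definition noise_identity_tester ::
  "nat \<Rightarrow> nat pmf \<Rightarrow> nat pmf \<Rightarrow> real \<Rightarrow> nat \<Rightarrow> sample_algorithm \<Rightarrow> bool" where
  "noise_identity_tester n q1 q2 \<epsilon> m A \<longleftrightarrow>
     (\<forall>p. dist_on n p \<longrightarrow>
        ((\<exists>\<alpha>\<in>{0..1}. pmf p = noisy_mixture \<alpha> q1 q2) \<longrightarrow>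
           pmf (run_on_samples A m p) Accept \<ge> 2/3) \<and>
        ((\<forall>\<alpha>\<in>{0..1}. l1_dist n (pmf p) (noisy_mixture \<alpha> q1 q2) \<ge> \<epsilon>) \<longrightarrow>
           pmf (run_on_samples A m p) Reject \<ge> 2/3))"

end

theory Submission imports Defs begin

text \<open>
  Upper bound. Work in the inner product \<open>\<langle>f, g\<rangle> = (\<Sum>x. f x * g x / w x)\<close> with weights
  \<open>w = q1 + q2 + 1 / n\<close>. In this geometry the mixtures of \<open>q1\<close> and \<open>q2\<close> form a segment in a plane, and
  the squared distance of \<open>p\<close> from that plane is a quadratic form in \<open>p\<close>. It therefore has an unbiased
  estimator built from pairs of samples, and the mixture parameter never has to be learned. For a
  mixture the kernel of this estimator is degenerate, and its standard deviation is at most of order \<open>sqrt n / m\<close>; being \<open>\<epsilon>\<close>-far in \<open>l\<^sub>1\<close> means a squared distance of order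
  \<open>\<epsilon>\<^sup>2\<close>. So \<open>m\<close> of order \<open>sqrt n / \<epsilon>\<^sup>2\<close> is enough, provided that two gaps are closed.

  First, the variance bound needs the energy \<open>\<Sum>x. (p x / w x)\<^sup>2\<close> to be of order \<open>n\<close>, as it is for
  mixtures; a weighted collision count detects if it is larger. Second, a distribution near the plane
  may be near a point of the line through \<open>q1\<close> and \<open>q2\<close> beyond the end points of the segment; then its
  probability of the event \<open>q2 < q1\<close> lies outside the range spanned by \<open>q1\<close> and \<open>q2\<close>
  (lemma \<open>far_from_segment_near_line\<close>), which an empirical frequency detects. All deviation
  bounds are instances of Chebyshev's inequality (lemmas \<open>pair_sum_Chebyshev\<close> and
  \<open>sum_list_Chebyshev\<close>), and \<open>noise_tester_exists\<close> combines the three checks.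

  Lower bound. Take \<open>q1 = q2\<close> uniform on an even number \<open>2 k\<close> of elements, so that the task becomes
  uniformity testing. If the elements are paired and the probabilities in each pair are changed to
  \<open>(1 + \<epsilon>) / (2 k)\<close> and \<open>(1 - \<epsilon>) / (2 k)\<close> in a random order, the resulting distribution is \<open>\<epsilon>\<close>-far
  from uniform, yet the chi-square divergence between the average law of \<open>m\<close> samples and the law under
  the uniform distribution is at most \<open>exp (m\<^sup>2 \<epsilon>\<^sup>4 / (2 k)) - 1\<close>
  (lemmas \<open>mixture_second_moment_lower_bound\<close> and \<open>uniformity_lower_bound\<close>).
\<close>

section \<open>Expectations over independent samples\<close>

text \<open>The expected value of \<open>f\<close> on a list of \<open>m\<close> independent draws from the weights \<open>p\<close> on \<open>X\<close>.
Finite sums, peeled off one draw at a time, make every moment computation below an induction on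
\<open>m\<close> without any integrability side condition. The total mass of \<open>p\<close> is left free, so the weights
can be multiplied by a likelihood ratio without having to be a distribution.\<close>

primrec iid_mean :: "'a set \<Rightarrow> ('a \<Rightarrow> real) \<Rightarrow> nat \<Rightarrow> ('a list \<Rightarrow> real) \<Rightarrow> real" where
  "iid_mean X p 0 f = f []"
| "iid_mean X p (Suc m) f = (\<Sum>x\<in>X. p x * iid_mean X p m (\<lambda>xs. f (x # xs)))"

lemma pmf_run_on_samples:
  assumes "finite X" "set_pmf p \<subseteq> X"
  shows "pmf (run_on_samples A m p) v = iid_mean X (pmf p) m (\<lambda>xs. pmf (A xs) v)"
  unfolding run_on_samples_def
proof (induction m arbitrary: A)
  case 0
  show ?case by (simp add: bind_return_pmf)
next
  case (Suc m)
  have "bind_pmf (replicate_pmf (Suc m) p) A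
      = bind_pmf p (\<lambda>x. bind_pmf (replicate_pmf m p) (\<lambda>xs. A (x # xs)))"
    by (simp add: bind_assoc_pmf bind_return_pmf)
  then have "pmf (bind_pmf (replicate_pmf (Suc m) p) A) v
      = (\<integral>x. iid_mean X (pmf p) m (\<lambda>xs. pmf (A (x # xs)) v) \<partial>measure_pmf p)"
    by (simp only: pmf_bind[of p] Suc.IH)
  also have "\<dots> = (\<Sum>x\<in>X. pmf p x *\<^sub>R iid_mean X (pmf p) m (\<lambda>xs. pmf (A (x # xs)) v))"
    using assms by (intro integral_measure_pmf) auto
  finally show ?case by simp
qed

lemma iid_mean_add:
  "iid_mean X p m (\<lambda>xs. f xs + g xs) = iid_mean X p m f + iid_mean X p m g"
  by (induction m arbitrary: f g) (simp_all add: sum.distrib algebra_simps)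

lemma iid_mean_cmult: "iid_mean X p m (\<lambda>xs. c * f xs) = c * iid_mean X p m f"
  by (induction m arbitrary: f) (simp_all add: sum_distrib_left algebra_simps)

lemma iid_mean_diff:
  "iid_mean X p m (\<lambda>xs. f xs - g xs) = iid_mean X p m f - iid_mean X p m g"
  using iid_mean_add[of X p m f "\<lambda>xs. - 1 * g xs"] iid_mean_cmult[of X p m "- 1" g] by simp

lemma iid_mean_sum:
  "iid_mean X p m (\<lambda>xs. \<Sum>i\<in>I. f i xs) = (\<Sum>i\<in>I. iid_mean X p m (f i))"
proof (induction m arbitrary: f)
  case (Suc m)
  show ?case
    by (simp add: Suc.IH sum_distrib_left) (rule sum.swap)
qed simp

lemma iid_mean_const:
  "(\<Sum>x\<in>X. p x) = 1 \<Longrightarrow> iid_mean X p m (\<lambda>_. c) = c"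
  by (induction m) (simp_all flip: sum_distrib_right)

lemma iid_mean_mono:
  assumes "\<And>x. x \<in> X \<Longrightarrow> 0 \<le> p x"
    and "\<And>xs. set xs \<subseteq> X \<Longrightarrow> length xs = m \<Longrightarrow> f xs \<le> g xs"
  shows "iid_mean X p m f \<le> iid_mean X p m g"
  using assms(2)
proof (induction m arbitrary: f g)
  case (Suc m)
  show ?case
    unfolding iid_mean.simps
    by (intro sum_mono mult_left_mono Suc.IH assms(1) Suc.prems) auto
qed simp

lemma iid_mean_cong:
  assumes "\<And>xs. set xs \<subseteq> X \<Longrightarrow> length xs = m \<Longrightarrow> f xs = g xs"
  shows "iid_mean X p m f = iid_mean X p m g"
  using assms
proof (induction m arbitrary: f g)
  case (Suc m)
  have "iid_mean X p m (\<lambda>xs. f (x # xs)) = iid_mean X p m (\<lambda>xs. g (x # xs))" if "x \<in> X" for x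
    using that by (intro Suc.IH Suc.prems) auto
  then show ?case by simp
qed simp

section \<open>Sums over samples and over pairs of samples\<close>

lemma iid_mean_sum_list:
  assumes "(\<Sum>x\<in>X. p x) = 1"
  shows "iid_mean X p m (\<lambda>xs. \<Sum>x\<leftarrow>xs. f x) = real m * (\<Sum>x\<in>X. p x * f x)"
  using assms
  by (induction m)
    (simp_all add: iid_mean_add iid_mean_const distrib_left sum.distrib
       flip: sum_distrib_right, simp add: algebra_simps)

text \<open>Equal positions contribute the diagonal term, distinct positions factorise by independence.\<close>

lemma iid_mean_sum_list_mult_sum_list:
  assumes p1: "(\<Sum>x\<in>X. p x) = 1"
  shows "iid_mean X p m (\<lambda>xs. (\<Sum>x\<leftarrow>xs. f x) * (\<Sum>x\<leftarrow>xs. g x))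
    = real m * (\<Sum>x\<in>X. p x * (f x * g x))
      + real m * (real m - 1) * (\<Sum>x\<in>X. p x * f x) * (\<Sum>x\<in>X. p x * g x)"
proof (induction m)
  case (Suc m)
  let ?F = "\<lambda>xs. \<Sum>x\<leftarrow>xs. f x" and ?G = "\<lambda>xs. \<Sum>x\<leftarrow>xs. g x"
  let ?f = "\<Sum>x\<in>X. p x * f x" and ?g = "\<Sum>x\<in>X. p x * g x"
    and ?fg = "\<Sum>x\<in>X. p x * (f x * g x)"
  have step: "iid_mean X p m (\<lambda>xs. ?F (x # xs) * ?G (x # xs))
      = f x * g x + (f x * (m * ?g) + (g x * (m * ?f) + iid_mean X p m (\<lambda>xs. ?F xs * ?G xs)))" for x
  proof -
    have "(\<lambda>xs. ?F (x # xs) * ?G (x # xs))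
        = (\<lambda>xs. f x * g x + (f x * ?G xs + (g x * ?F xs + ?F xs * ?G xs)))"
      by (auto simp: algebra_simps)
    then show ?thesis
      by (simp only: iid_mean_add iid_mean_cmult iid_mean_const[OF p1] iid_mean_sum_list[OF p1])
  qed
  have "iid_mean X p (Suc m) (\<lambda>xs. ?F xs * ?G xs)
      = (\<Sum>x\<in>X. p x * (f x * g x + (f x * (m * ?g) + (g x * (m * ?f)
           + iid_mean X p m (\<lambda>xs. ?F xs * ?G xs)))))"
    by (simp only: iid_mean.simps step)
  also have "\<dots> = ?fg + (\<Sum>x\<in>X. (p x * f x) * (m * ?g)) + (\<Sum>x\<in>X. (p x * g x) * (m * ?f))
      + (\<Sum>x\<in>X. p x * iid_mean X p m (\<lambda>xs. ?F xs * ?G xs))"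
    by (simp add: distrib_left sum.distrib mult.assoc)
  also have "\<dots> = ?fg + ?f * (m * ?g) + ?g * (m * ?f) + iid_mean X p m (\<lambda>xs. ?F xs * ?G xs)"
    by (simp only: p1 mult_1 flip: sum_distrib_right)
  finally show ?case
    unfolding Suc.IH by (simp add: algebra_simps)
qed simp

primrec pair_sum :: "('a \<Rightarrow> 'a \<Rightarrow> real) \<Rightarrow> 'a list \<Rightarrow> real" where
  "pair_sum h [] = 0"
| "pair_sum h (x # xs) = (\<Sum>y\<leftarrow>xs. h x y) + pair_sum h xs"

lemma pair_sum_diff_const:
  "pair_sum (\<lambda>x y. h x y - c) xs = pair_sum h xs - c * (real (length xs) * (real (length xs) - 1) / 2)"
  by (induction xs) (simp_all add: sum_list_subtractf sum_list_const_mult sum_list_triv field_simps)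

text \<open>The second moment of a U-statistic whose kernel has mean zero. Expanding the square over pairs of
pairs of positions, disjoint pairs contribute nothing, pairs that share one position contribute
\<open>z1\<close>, and identical pairs contribute \<open>z2\<close>. The proof obtains these counts by recursion on the
sample size, for which the mixed moment of \<open>pair_sum h\<close> with the sum of \<open>h1\<close> is needed as well.\<close>

lemma centred_pair_sum_variance:
  fixes h :: "'a \<Rightarrow> 'a \<Rightarrow> real"
  assumes p1: "(\<Sum>x\<in>X. p x) = 1"
    and sym: "\<And>x y. h x y = h y x"
    and h1: "\<And>x. x \<in> X \<Longrightarrow> (\<Sum>y\<in>X. p y * h x y) = h1 x"
    and centred: "(\<Sum>x\<in>X. p x * h1 x) = 0"
  defines "z1 \<equiv> \<Sum>x\<in>X. p x * (h1 x)\<^sup>2"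
    and "z2 \<equiv> \<Sum>x\<in>X. p x * (\<Sum>y\<in>X. p y * (h x y)\<^sup>2)"
  shows "iid_mean X p m (\<lambda>xs. (pair_sum h xs)\<^sup>2)
      = real m * (real m - 1) / 2 * z2 + real m * (real m - 1) * (real m - 2) * z1"
proof -
  have mean0: "iid_mean X p m (pair_sum h) = 0" for m
  proof (induction m)
    case (Suc m)
    have "iid_mean X p (Suc m) (pair_sum h) = (\<Sum>x\<in>X. p x * (m * h1 x))"
      by (auto simp: iid_mean_add iid_mean_sum_list[OF p1] h1 Suc.IH intro!: sum.cong)
    also have "\<dots> = m * (\<Sum>x\<in>X. p x * h1 x)"
      by (simp add: sum_distrib_left algebra_simps)
    finally show ?case by (simp add: centred)
  qed simp
  \<comment> \<open>Averaging over the newly prepended point turns its interaction with the tail into a sum of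
    \<open>h1\<close> over the tail; this is what closes both recursions below.\<close>
  have avg: "(\<Sum>x\<in>X. p x * iid_mean X p m (\<lambda>xs. F xs * (\<Sum>y\<leftarrow>xs. h x y)))
      = iid_mean X p m (\<lambda>xs. F xs * (\<Sum>y\<leftarrow>xs. h1 y))" for m F
  proof -
    have "(\<Sum>x\<in>X. p x * (\<Sum>y\<leftarrow>xs. h x y)) = (\<Sum>y\<leftarrow>xs. h1 y)" if "set xs \<subseteq> X" for xs
      using that
    proof (induction xs)
      case (Cons a xs)
      have "(\<Sum>x\<in>X. p x * h x a) = h1 a"
        using h1[of a] Cons.prems by (simp add: sym)
      with Cons show ?case by (simp add: distrib_left sum.distrib)
    qed simp
    then have "iid_mean X p m (\<lambda>xs. \<Sum>x\<in>X. p x * (F xs * (\<Sum>y\<leftarrow>xs. h x y)))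
        = iid_mean X p m (\<lambda>xs. F xs * (\<Sum>y\<leftarrow>xs. h1 y))"
      by (intro iid_mean_cong) (simp add: mult.left_commute flip: sum_distrib_left)
    then show ?thesis by (simp add: iid_mean_sum iid_mean_cmult)
  qed
  have cross: "iid_mean X p m (\<lambda>xs. pair_sum h xs * (\<Sum>x\<leftarrow>xs. h1 x)) = real m * (real m - 1) * z1" for m
  proof (induction m)
    case (Suc m)
    have step: "iid_mean X p m (\<lambda>xs. pair_sum h (x # xs) * (\<Sum>y\<leftarrow>x # xs. h1 y))
      = iid_mean X p m (\<lambda>xs. pair_sum h xs * (\<Sum>y\<leftarrow>xs. h1 y)) + (m * (h1 x)\<^sup>2
        + iid_mean X p m (\<lambda>xs. (\<Sum>y\<leftarrow>xs. h1 y) * (\<Sum>y\<leftarrow>xs. h x y)))" if "x \<in> X" for x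
    proof -
      have "(\<lambda>xs. pair_sum h (x # xs) * (\<Sum>y\<leftarrow>x # xs. h1 y))
        = (\<lambda>xs. h1 x * pair_sum h xs + (pair_sum h xs * (\<Sum>y\<leftarrow>xs. h1 y)
           + (h1 x * (\<Sum>y\<leftarrow>xs. h x y) + (\<Sum>y\<leftarrow>xs. h1 y) * (\<Sum>y\<leftarrow>xs. h x y))))"
        by (auto simp: algebra_simps)
      then show ?thesis
        using that
        by (simp only: iid_mean_add iid_mean_cmult mean0 iid_mean_sum_list[OF p1] h1)
          (simp add: power2_eq_square)
    qed
    have "iid_mean X p (Suc m) (\<lambda>xs. pair_sum h xs * (\<Sum>x\<leftarrow>xs. h1 x))
      = (\<Sum>x\<in>X. p x * (iid_mean X p m (\<lambda>xs. pair_sum h xs * (\<Sum>y\<leftarrow>xs. h1 y)) + (m * (h1 x)\<^sup>2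
        + iid_mean X p m (\<lambda>xs. (\<Sum>y\<leftarrow>xs. h1 y) * (\<Sum>y\<leftarrow>xs. h x y)))))"
      unfolding iid_mean.simps by (intro sum.cong refl arg_cong2[where f="(*)"] step)
    also have "\<dots> = iid_mean X p m (\<lambda>xs. pair_sum h xs * (\<Sum>y\<leftarrow>xs. h1 y)) + m * z1
        + iid_mean X p m (\<lambda>xs. (\<Sum>y\<leftarrow>xs. h1 y) * (\<Sum>y\<leftarrow>xs. h1 y))"
      using p1
      by (simp add: distrib_left sum.distrib avg z1_def sum_distrib_left mult.left_commute
          flip: sum_distrib_right)
    also have "\<dots> = real m * (real m - 1) * z1 + m * z1 + m * z1"
      unfolding Suc.IH iid_mean_sum_list_mult_sum_list[OF p1] centred z1_def
      by (simp add: power2_eq_square)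
    finally show ?case by (simp add: algebra_simps)
  qed simp
  show "iid_mean X p m (\<lambda>xs. (pair_sum h xs)\<^sup>2)
      = real m * (real m - 1) / 2 * z2 + real m * (real m - 1) * (real m - 2) * z1"
  proof (induction m)
    case (Suc m)
    have step: "iid_mean X p m (\<lambda>xs. (pair_sum h (x # xs))\<^sup>2)
      = iid_mean X p m (\<lambda>xs. (pair_sum h xs)\<^sup>2)
        + (2 * iid_mean X p m (\<lambda>xs. pair_sum h xs * (\<Sum>y\<leftarrow>xs. h x y))
        + (m * (\<Sum>y\<in>X. p y * (h x y)\<^sup>2) + m * (real m - 1) * (h1 x)\<^sup>2))" if "x \<in> X" for x
    proof -
      have "(\<lambda>xs. (pair_sum h (x # xs))\<^sup>2) = (\<lambda>xs. (pair_sum h xs)\<^sup>2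
          + (2 * (pair_sum h xs * (\<Sum>y\<leftarrow>xs. h x y)) + (\<Sum>y\<leftarrow>xs. h x y) * (\<Sum>y\<leftarrow>xs. h x y)))"
        by (auto simp: algebra_simps power2_eq_square)
      then show ?thesis
        using that
        by (simp only: iid_mean_add iid_mean_cmult iid_mean_sum_list_mult_sum_list[OF p1] h1)
          (simp add: power2_eq_square mult.assoc)
    qed
    have "iid_mean X p (Suc m) (\<lambda>xs. (pair_sum h xs)\<^sup>2)
      = (\<Sum>x\<in>X. p x * (iid_mean X p m (\<lambda>xs. (pair_sum h xs)\<^sup>2)
        + (2 * iid_mean X p m (\<lambda>xs. pair_sum h xs * (\<Sum>y\<leftarrow>xs. h x y))
        + (m * (\<Sum>y\<in>X. p y * (h x y)\<^sup>2) + m * (real m - 1) * (h1 x)\<^sup>2))))"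
      unfolding iid_mean.simps by (intro sum.cong refl arg_cong2[where f="(*)"] step)
    also have "\<dots> = (\<Sum>x\<in>X. p x * iid_mean X p m (\<lambda>xs. (pair_sum h xs)\<^sup>2))
        + 2 * (\<Sum>x\<in>X. p x * iid_mean X p m (\<lambda>xs. pair_sum h xs * (\<Sum>y\<leftarrow>xs. h x y)))
        + m * z2 + m * (real m - 1) * z1"
      unfolding z1_def z2_def sum_distrib_left[of _ _ X] sum.distrib[symmetric]
      by (intro sum.cong refl) (simp add: algebra_simps sum_distrib_left)
    also have "\<dots> = iid_mean X p m (\<lambda>xs. (pair_sum h xs)\<^sup>2)
        + 2 * (real m * (real m - 1) * z1) + m * z2 + m * (real m - 1) * z1"
      unfolding avg cross using p1 by (simp flip: sum_distrib_right)
    finally show ?case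
      unfolding Suc.IH by (simp add: field_simps)
  qed simp
qed

text \<open>The two terms of the bound correspond to the two kinds of coinciding positions. The one with \<open>z1\<close>,
the second moment of the kernel averaged over one argument, decays only like \<open>1 / m\<close>; for the
projection statistic below it vanishes on every mixture of the known distributions, and this is what
gives the square-root dependence on the size of the domain.\<close>

lemma pair_sum_Chebyshev:
  fixes h :: "'a \<Rightarrow> 'a \<Rightarrow> real"
  assumes p0: "\<And>x. x \<in> X \<Longrightarrow> 0 \<le> p x" and p1: "(\<Sum>x\<in>X. p x) = 1"
    and sym: "\<And>x y. h x y = h y x"
    and h1: "\<And>x. x \<in> X \<Longrightarrow> (\<Sum>y\<in>X. p y * h x y) = h1 x"
    and theta: "(\<Sum>x\<in>X. p x * h1 x) = \<theta>"
    and z1: "(\<Sum>x\<in>X. p x * (h1 x)\<^sup>2) \<le> z1"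
    and z2: "(\<Sum>x\<in>X. p x * (\<Sum>y\<in>X. p y * (h x y)\<^sup>2)) \<le> z2"
    and m: "2 \<le> m" and d: "0 < d"
  defines "N \<equiv> real m * (real m - 1) / 2"
  shows "iid_mean X p m (\<lambda>xs. of_bool (N * d \<le> \<bar>pair_sum h xs - N * \<theta>\<bar>))
    \<le> 4 * z2 / (real m * d)\<^sup>2 + 8 * z1 / (real m * d\<^sup>2)"
proof -
  define k where "k = (\<lambda>x y. h x y - \<theta>)"
  have k1: "(\<Sum>y\<in>X. p y * k x y) = h1 x - \<theta>" if "x \<in> X" for x
    using that p1 h1 by (simp add: k_def right_diff_distrib sum_subtractf flip: sum_distrib_right)
  have k0: "(\<Sum>x\<in>X. p x * (h1 x - \<theta>)) = 0"
    using p1 theta by (simp add: right_diff_distrib sum_subtractf flip: sum_distrib_right)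
  have ksym: "k x y = k y x" for x y using sym by (simp add: k_def)
  have centre: "(\<Sum>x\<in>X. p x * (f x - c)\<^sup>2) = (\<Sum>x\<in>X. p x * (f x)\<^sup>2) - 2 * c * (\<Sum>x\<in>X. p x * f x) + c\<^sup>2" for f c
  proof -
    have "(\<Sum>x\<in>X. p x * (f x - c)\<^sup>2) = (\<Sum>x\<in>X. p x * (f x)\<^sup>2 - 2 * c * (p x * f x) + p x * c\<^sup>2)"
      by (intro sum.cong refl) (simp add: power2_eq_square algebra_simps)
    then show ?thesis
      using p1 by (simp add: sum.distrib sum_subtractf flip: sum_distrib_left sum_distrib_right)
  qed
  have k2: "iid_mean X p m (\<lambda>xs. (pair_sum k xs)\<^sup>2)
      = real m * (real m - 1) / 2 * (\<Sum>x\<in>X. p x * (\<Sum>y\<in>X. p y * (k x y)\<^sup>2))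
        + real m * (real m - 1) * (real m - 2) * (\<Sum>x\<in>X. p x * (h1 x - \<theta>)\<^sup>2)"
    by (rule centred_pair_sum_variance[where h = k, OF p1 ksym _ k0]) (rule k1)
  \<comment> \<open>Centring a variable can only decrease its second moment.\<close>
  have le1: "(\<Sum>x\<in>X. p x * (h1 x - \<theta>)\<^sup>2) \<le> z1"
    using z1 zero_le_square[of \<theta>]
    unfolding centre theta power2_eq_square[of \<theta>] mult.assoc by linarith
  have "(\<Sum>x\<in>X. p x * (\<Sum>y\<in>X. p y * (k x y)\<^sup>2))
      = (\<Sum>x\<in>X. p x * ((\<Sum>y\<in>X. p y * (h x y)\<^sup>2) - 2 * \<theta> * h1 x + \<theta>\<^sup>2))"
    unfolding k_def centre by (intro sum.cong refl) (simp add: h1)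
  also have "\<dots> = (\<Sum>x\<in>X. p x * (\<Sum>y\<in>X. p y * (h x y)\<^sup>2)) - 2 * \<theta> * (\<Sum>x\<in>X. p x * h1 x)
      + (\<Sum>x\<in>X. p x) * \<theta>\<^sup>2"
    unfolding sum_distrib_left[of "2 * \<theta>"] sum_distrib_right[of _ X "\<theta>\<^sup>2"]
      sum_subtractf[symmetric] sum.distrib[symmetric]
    by (intro sum.cong refl) (simp add: algebra_simps)
  also have "\<dots> \<le> z2"
    using z2 zero_le_square[of \<theta>]
    unfolding theta p1 power2_eq_square[of \<theta>] mult.assoc by linarith
  finally have le2: "(\<Sum>x\<in>X. p x * (\<Sum>y\<in>X. p y * (k x y)\<^sup>2)) \<le> z2" .
  have Npos: "N > 0" using m by (simp add: N_def)
  have mN: "(real m)\<^sup>2 \<le> 4 * N"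
  proof -
    have "real m * 2 \<le> real m * real m" using m by (intro mult_left_mono) auto
    then show ?thesis by (simp add: N_def power2_eq_square field_simps)
  qed
  have nonneg: "0 \<le> z1" "0 \<le> z2"
    by (rule order_trans[OF _ z1] order_trans[OF _ z2],
        intro sum_nonneg mult_nonneg_nonneg p0 zero_le_power2, assumption+)+
  have "iid_mean X p m (\<lambda>xs. of_bool (N * d \<le> \<bar>pair_sum h xs - N * \<theta>\<bar>))
      \<le> iid_mean X p m (\<lambda>xs. 1 / (N * d)\<^sup>2 * (pair_sum k xs)\<^sup>2)"
  proof (rule iid_mean_mono)
    fix xs :: "'a list" assume "length xs = m"
    then have eq: "pair_sum k xs = pair_sum h xs - N * \<theta>"
      unfolding k_def pair_sum_diff_const by (simp add: N_def)
    have "1 \<le> 1 / (N * d)\<^sup>2 * (pair_sum k xs)\<^sup>2" if "N * d \<le> \<bar>pair_sum k xs\<bar>"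
    proof -
      have "(N * d)\<^sup>2 \<le> \<bar>pair_sum k xs\<bar>\<^sup>2" using that Npos d by (intro power_mono) auto
      then show ?thesis using Npos d by (simp add: field_simps)
    qed
    then show "of_bool (N * d \<le> \<bar>pair_sum h xs - N * \<theta>\<bar>) \<le> 1 / (N * d)\<^sup>2 * (pair_sum k xs)\<^sup>2"
      unfolding eq[symmetric] by auto
  qed (use p0 in auto)
  also have "\<dots> = (N * (\<Sum>x\<in>X. p x * (\<Sum>y\<in>X. p y * (k x y)\<^sup>2))
      + 2 * N * (real m - 2) * (\<Sum>x\<in>X. p x * (h1 x - \<theta>)\<^sup>2)) / (N * d)\<^sup>2"
    unfolding iid_mean_cmult k2
    by (simp add: N_def)
  also have "\<dots> \<le> (N * z2 + 2 * N * real m * z1) / (N * d)\<^sup>2"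
    using le1 le2 m Npos nonneg p0
    by (intro divide_right_mono add_mono mult_mono) (auto intro!: sum_nonneg mult_nonneg_nonneg)
  also have "\<dots> = (z2 / d\<^sup>2 + 2 * real m * z1 / d\<^sup>2) / N"
    using Npos d by (simp add: field_simps power2_eq_square)
  also have "\<dots> \<le> (z2 / d\<^sup>2 + 2 * real m * z1 / d\<^sup>2) / ((real m)\<^sup>2 / 4)"
    using mN Npos m nonneg by (intro divide_left_mono) auto
  also have "\<dots> = 4 * z2 / (real m * d)\<^sup>2 + 8 * z1 / (real m * d\<^sup>2)"
    using m d by (simp add: field_simps power2_eq_square)
  finally show ?thesis .
qed

lemma sum_list_Chebyshev:
  assumes p0: "\<And>x. x \<in> X \<Longrightarrow> 0 \<le> p x" and p1: "(\<Sum>x\<in>X. p x) = 1"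
    and m: "0 < m" and d: "0 < d" and f: "\<And>x. x \<in> X \<Longrightarrow> \<bar>f x\<bar> \<le> 1"
  shows "iid_mean X p m (\<lambda>xs. of_bool (real m * d \<le> \<bar>(\<Sum>x\<leftarrow>xs. f x) - real m * (\<Sum>x\<in>X. p x * f x)\<bar>))
    \<le> 1 / (real m * d\<^sup>2)"
proof -
  define \<mu> where "\<mu> = (\<Sum>x\<in>X. p x * f x)"
  have "iid_mean X p m (\<lambda>xs. of_bool (real m * d \<le> \<bar>(\<Sum>x\<leftarrow>xs. f x) - real m * \<mu>\<bar>))
      \<le> iid_mean X p m (\<lambda>xs. 1 / (real m * d)\<^sup>2 * ((\<Sum>x\<leftarrow>xs. f x - \<mu>) * (\<Sum>x\<leftarrow>xs. f x - \<mu>)))"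
  proof (rule iid_mean_mono)
    fix xs :: "'a list" assume "length xs = m"
    then have eq: "(\<Sum>x\<leftarrow>xs. f x - \<mu>) = (\<Sum>x\<leftarrow>xs. f x) - real m * \<mu>"
      by (simp add: sum_list_subtractf sum_list_triv)
    have "1 \<le> 1 / (real m * d)\<^sup>2 * (t * t)" if "real m * d \<le> \<bar>t\<bar>" for t
    proof -
      have "(real m * d)\<^sup>2 \<le> \<bar>t\<bar>\<^sup>2" using that d by (intro power_mono) auto
      then show ?thesis using m d by (simp add: field_simps power2_eq_square)
    qed
    then show "of_bool (real m * d \<le> \<bar>(\<Sum>x\<leftarrow>xs. f x) - real m * \<mu>\<bar>)
        \<le> 1 / (real m * d)\<^sup>2 * ((\<Sum>x\<leftarrow>xs. f x - \<mu>) * (\<Sum>x\<leftarrow>xs. f x - \<mu>))"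
      unfolding eq[symmetric] by auto
  qed (use p0 in auto)
  also have "\<dots> = 1 / (real m * d)\<^sup>2 * (real m * (\<Sum>x\<in>X. p x * ((f x - \<mu>) * (f x - \<mu>))))"
    unfolding iid_mean_cmult iid_mean_sum_list_mult_sum_list[OF p1]
    using p1 by (simp add: right_diff_distrib sum_subtractf \<mu>_def flip: sum_distrib_right)
  also have "\<dots> \<le> 1 / (real m * d)\<^sup>2 * (real m * 1)"
  proof (intro mult_left_mono)
    have "(\<Sum>x\<in>X. p x * ((f x - \<mu>) * (f x - \<mu>)))
        = (\<Sum>x\<in>X. p x * (f x)\<^sup>2 - 2 * \<mu> * (p x * f x) + p x * \<mu>\<^sup>2)"
      by (intro sum.cong refl) (simp add: power2_eq_square algebra_simps)
    also have "\<dots> = (\<Sum>x\<in>X. p x * (f x)\<^sup>2) - \<mu>\<^sup>2"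
      using p1
      by (simp add: sum.distrib sum_subtractf flip: sum_distrib_left sum_distrib_right)
        (simp add: \<mu>_def power2_eq_square)
    also have "\<dots> \<le> (\<Sum>x\<in>X. p x * 1)"
    proof -
      have "(\<Sum>x\<in>X. p x * (f x)\<^sup>2) \<le> (\<Sum>x\<in>X. p x * 1)"
        using f p0 by (intro sum_mono mult_left_mono) (auto simp: abs_square_le_1)
      then show ?thesis by (smt (verit) zero_le_power2)
    qed
    finally show "(\<Sum>x\<in>X. p x * ((f x - \<mu>) * (f x - \<mu>))) \<le> 1" using p1 by simp
  qed auto
  also have "\<dots> = 1 / (real m * d\<^sup>2)"
    using m d by (simp add: field_simps power2_eq_square)
  finally show ?thesis unfolding \<mu>_def .
qed

section \<open>Weighted geometry of the plane spanned by two distributions\<close>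

text \<open>The weighted inner product. With weights \<open>w\<close> that dominate the two known distributions and
never fall below \<open>1 / n\<close>, it plays the role that the ordinary inner product plays when
all probabilities are of order \<open>1 / n\<close>: heavy elements are rescaled instead of being split.\<close>

definition wip :: "'a set \<Rightarrow> ('a \<Rightarrow> real) \<Rightarrow> ('a \<Rightarrow> real) \<Rightarrow> ('a \<Rightarrow> real) \<Rightarrow> real" where
  "wip X w f g = (\<Sum>x\<in>X. f x * g x / w x)"

lemma wip_commute: "wip X w f g = wip X w g f"
  by (simp add: wip_def mult.commute)

lemma wip_diff_left: "wip X w (\<lambda>x. f x - g x) h = wip X w f h - wip X w g h"
  by (simp add: wip_def left_diff_distrib diff_divide_distrib sum_subtractf)

lemma wip_add_left: "wip X w (\<lambda>x. f x + g x) h = wip X w f h + wip X w g h"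
  by (simp add: wip_def distrib_right add_divide_distrib sum.distrib)

lemma wip_cmult_left: "wip X w (\<lambda>x. c * f x) h = c * wip X w f h"
  by (simp add: wip_def sum_distrib_left algebra_simps)

lemma wip_cong:
  "(\<And>x. x \<in> X \<Longrightarrow> f x = f' x) \<Longrightarrow> (\<And>x. x \<in> X \<Longrightarrow> g x = g' x) \<Longrightarrow> wip X w f g = wip X w f' g'"
  unfolding wip_def by (intro sum.cong) auto

lemma wip_self_nonneg: "(\<And>x. x \<in> X \<Longrightarrow> 0 < w x) \<Longrightarrow> 0 \<le> wip X w f f"
  unfolding wip_def by (intro sum_nonneg divide_nonneg_pos) auto

lemma wip_self_eq_0_iff:
  assumes "finite X" "\<And>x. x \<in> X \<Longrightarrow> 0 < w x"
  shows "wip X w f f = 0 \<longleftrightarrow> (\<forall>x\<in>X. f x = 0)"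
proof -
  have "\<And>x. x \<in> X \<Longrightarrow> 0 \<le> f x * f x / w x"
    using assms(2) by (intro divide_nonneg_pos) auto
  then show ?thesis
    unfolding wip_def using assms by (subst sum_nonneg_eq_0_iff) (auto simp: less_le)
qed

text \<open>The second vector may vanish: the two known distributions need not be linearly independent, and may
even coincide.\<close>

definition orthonormal_pair :: "'a set \<Rightarrow> ('a \<Rightarrow> real) \<Rightarrow> ('a \<Rightarrow> real) \<Rightarrow> ('a \<Rightarrow> real) \<Rightarrow> bool" where
  "orthonormal_pair X w u v \<longleftrightarrow> wip X w u u = 1 \<and> wip X w u v = 0 \<and> (wip X w v v = 1 \<or> v = (\<lambda>_. 0))"

lemma Gram_Schmidt_pair:
  fixes X :: "'a set" and w q1 q2 :: "'a \<Rightarrow> real"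
  assumes fin: "finite X" and w: "\<And>x. x \<in> X \<Longrightarrow> 0 < w x" and nz: "\<exists>x\<in>X. q1 x \<noteq> 0"
  obtains u v :: "'a \<Rightarrow> real" and a b c a' b' c' :: real where "orthonormal_pair X w u v"
    "\<And>x. x \<in> X \<Longrightarrow> q1 x = a * u x" "\<And>x. x \<in> X \<Longrightarrow> q2 x = b * u x + c * v x"
    "\<And>x. u x = a' * q1 x" "\<And>x. v x = b' * q1 x + c' * q2 x"
proof -
  have nn: "0 \<le> wip X w f f" for f
    by (rule wip_self_nonneg) (rule w)
  have iff: "wip X w f f = 0 \<longleftrightarrow> (\<forall>x\<in>X. f x = 0)" for f
    by (rule wip_self_eq_0_iff[OF fin]) (rule w)
  define a where "a = sqrt (wip X w q1 q1)"
  have "wip X w q1 q1 > 0"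
    using nn[of q1] iff[of q1] nz by (auto simp: less_le)
  then have a: "a > 0" "wip X w q1 q1 = a * a" by (simp_all add: a_def)
  define u where "u = (\<lambda>x. (1 / a) * q1 x)"
  have uu: "wip X w u u = 1"
    unfolding u_def wip_cmult_left wip_commute[of X w q1 "\<lambda>x. (1 / a) * q1 x"] a(2)
    using a(1) by simp
  define b where "b = wip X w q2 u"
  define v' where "v' = (\<lambda>x. q2 x - b * u x)"
  have v'u: "wip X w v' u = 0"
    by (simp add: v'_def wip_diff_left wip_cmult_left uu b_def)
  have q1: "q1 x = a * u x" for x using a by (simp add: u_def)
  show thesis
  proof (cases "wip X w v' v' = 0")
    case True
    then have "q2 x = b * u x" if "x \<in> X" for x
      using iff[of v'] that by (simp add: v'_def)
    moreover have "orthonormal_pair X w u (\<lambda>_. 0)"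
      using uu by (simp add: orthonormal_pair_def wip_def)
    ultimately show thesis
      by (intro that[of u "\<lambda>_. 0" a b 0 "1 / a" 0 0] q1) (simp_all add: u_def)
  next
    case False
    define c where "c = sqrt (wip X w v' v')"
    have c: "c > 0" "wip X w v' v' = c * c"
      using False nn[of v'] by (simp_all add: c_def)
    define v where "v = (\<lambda>x. (1 / c) * v' x)"
    have vv: "wip X w v v = 1"
      unfolding v_def wip_cmult_left wip_commute[of X w v' "\<lambda>x. (1 / c) * v' x"] c(2)
      using c(1) by simp
    have "wip X w v u = (1 / c) * wip X w v' u"
      unfolding v_def by (rule wip_cmult_left)
    then have "wip X w u v = 0"
      by (simp add: v'u wip_commute[of X w u v])
    then have "orthonormal_pair X w u v"
      using uu vv by (simp add: orthonormal_pair_def)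
    moreover have "q2 x = b * u x + c * v x" for x
      using c(1) by (simp add: v_def v'_def)
    moreover have "v x = (- b / (a * c)) * q1 x + (1 / c) * q2 x" for x
      using c(1) a(1) by (simp add: v_def v'_def u_def field_simps)
    ultimately show thesis
      by (intro that[of u v a b c "1 / a" "- b / (a * c)" "1 / c"] q1) (simp_all add: u_def)
  qed
qed

text \<open>The component of \<open>p\<close> orthogonal to the span of an orthonormal pair.\<close>

definition residual :: "'a set \<Rightarrow> ('a \<Rightarrow> real) \<Rightarrow> ('a \<Rightarrow> real) \<Rightarrow> ('a \<Rightarrow> real) \<Rightarrow> ('a \<Rightarrow> real) \<Rightarrow> 'a \<Rightarrow> real" where
  "residual X w u v p = (\<lambda>x. p x - wip X w p u * u x - wip X w p v * v x)"

lemma wip_residual: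
  assumes "orthonormal_pair X w u v"
  shows "wip X w p (residual X w u v p) = wip X w (residual X w u v p) (residual X w u v p)"
proof -
  let ?g = "residual X w u v p"
  have g: "wip X w ?g f = wip X w p f - wip X w p u * wip X w u f - wip X w p v * wip X w v f" for f
    by (simp add: residual_def wip_diff_left wip_cmult_left)
  have "wip X w v v = 1 \<or> wip X w p v = 0" "wip X w v u = 0" "wip X w u u = 1" "wip X w u v = 0"
    using assms wip_commute[of X w v u] by (auto simp: orthonormal_pair_def wip_def)
  then have "wip X w ?g u = 0" "wip X w p v * wip X w ?g v = 0"
    by (auto simp: g)
  then have "wip X w u ?g = 0" "wip X w p v * wip X w v ?g = 0"
    by (simp_all only: wip_commute[of X w ?g])
  then show ?thesis
    unfolding g[of ?g] by simp
qed

text \<open>Mixtures of the known distributions lie in the span, whatever the mixture parameter is. This is why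
the tester never has to estimate that parameter.\<close>

lemma residual_eq_0:
  assumes on: "orthonormal_pair X w u v"
    and p: "\<And>x. x \<in> X \<Longrightarrow> p x = s * u x + t * v x" and x: "x \<in> X"
  shows "residual X w u v p x = 0"
proof -
  have w: "wip X w p f = s * wip X w u f + t * wip X w v f" for f
    using wip_cong[of X p "\<lambda>x. s * u x + t * v x" f f w] p by (simp add: wip_add_left wip_cmult_left)
  show ?thesis
    using on x wip_commute[of X w v u] unfolding residual_def w
    by (auto simp: orthonormal_pair_def p)
qed

section \<open>Moments of the projection and collision kernels\<close>

text \<open>The inner product of the residuals of the point masses at \<open>x\<close> and at \<open>y\<close>, if \<open>u\<close> and \<open>v\<close> are an
orthonormal pair. Averaging it over two
independent draws gives the squared length of the residual of the sampled distribution, so its sum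
over pairs of samples is an unbiased estimate of the squared distance to the span.\<close>

definition projection_kernel :: "('a \<Rightarrow> real) \<Rightarrow> ('a \<Rightarrow> real) \<Rightarrow> ('a \<Rightarrow> real) \<Rightarrow> 'a \<Rightarrow> 'a \<Rightarrow> real" where
  "projection_kernel w u v x y
    = of_bool (x = y) / w x - u x / w x * (u y / w y) - v x / w x * (v y / w y)"

text \<open>A collision counter that discounts collisions at elements which are heavy under the known
distributions; its mean is the quantity called energy below.\<close>

definition collision_kernel :: "('a \<Rightarrow> real) \<Rightarrow> 'a \<Rightarrow> 'a \<Rightarrow> real" where
  "collision_kernel w x y = of_bool (x = y) / (w x)\<^sup>2"

text \<open>Energy bounds the variance of the projection statistic. It is at most the size of the domain for
every mixture of the known distributions, but can be much larger for an arbitrary distribution.\<close>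

definition energy :: "'a set \<Rightarrow> ('a \<Rightarrow> real) \<Rightarrow> ('a \<Rightarrow> real) \<Rightarrow> real" where
  "energy X w p = (\<Sum>x\<in>X. (p x / w x)\<^sup>2)"

lemma ratio_le_sqrt_energy:
  assumes "finite X" "x \<in> X"
  shows "p x / w x \<le> sqrt (energy X w p)"
proof -
  have "(p x / w x)\<^sup>2 \<le> energy X w p"
    unfolding energy_def using assms by (intro member_le_sum) auto
  then show ?thesis by (rule real_le_rsqrt)
qed

lemma energy_nonneg: "0 \<le> energy X w p"
  unfolding energy_def by (intro sum_nonneg) auto

text \<open>The factor \<open>p x / w x\<close> is bounded pointwise by the square root of the energy; this one estimate
controls both the variance of the averaged kernel (\<open>f\<close> the residual) and the contribution of the
two rank-one parts of the projection kernel (\<open>f\<close> a basis vector).\<close>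

lemma weighted_square_mean_le:
  assumes fin: "finite X" and w: "\<And>x. x \<in> X \<Longrightarrow> 0 < w x"
  shows "(\<Sum>x\<in>X. p x * (f x / w x)\<^sup>2) \<le> sqrt (energy X w p) * wip X w f f"
proof -
  have "(\<Sum>x\<in>X. p x * (f x / w x)\<^sup>2) = (\<Sum>x\<in>X. (p x / w x) * (f x * f x / w x))"
    using w by (intro sum.cong refl) (simp add: power2_eq_square)
  also have "\<dots> \<le> (\<Sum>x\<in>X. sqrt (energy X w p) * (f x * f x / w x))"
    using w by (intro sum_mono mult_right_mono ratio_le_sqrt_energy[OF fin] divide_nonneg_pos) auto
  finally show ?thesis by (simp add: wip_def sum_distrib_left)
qed

lemma projection_kernel_mean:
  assumes "finite X" "x \<in> X"
  shows "(\<Sum>y\<in>X. p y * projection_kernel w u v x y) = residual X w u v p x / w x"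
proof -
  have "(\<Sum>y\<in>X. p y * projection_kernel w u v x y)
      = (\<Sum>y\<in>X. (if x = y then p y / w y else 0) - u x / w x * (p y * u y / w y) - v x / w x * (p y * v y / w y))"
    by (intro sum.cong refl) (auto simp: projection_kernel_def algebra_simps)
  also have "\<dots> = p x / w x - u x / w x * wip X w p u - v x / w x * wip X w p v"
    unfolding sum_subtractf sum_distrib_left[symmetric] wip_def using assms by simp
  finally show ?thesis by (simp add: residual_def diff_divide_distrib mult.commute)
qed

text \<open>The diagonal part of the kernel contributes exactly the energy. Each rank-one part contributes the
square of a mean that is at most the root of the energy; the factor 9 comes from treating the three
parts separately.\<close>

lemma projection_kernel_second_moment:
  assumes fin: "finite X" and w: "\<And>x. x \<in> X \<Longrightarrow> 0 < w x" and p0: "\<And>x. x \<in> X \<Longrightarrow> 0 \<le> p x"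
    and on: "orthonormal_pair X w u v"
  shows "(\<Sum>x\<in>X. p x * (\<Sum>y\<in>X. p y * (projection_kernel w u v x y)\<^sup>2)) \<le> 9 * energy X w p"
proof -
  let ?M = "\<lambda>f. \<Sum>x\<in>X. p x * (f x / w x)\<^sup>2"
  have M: "(?M f)\<^sup>2 \<le> energy X w p" if "wip X w f f \<le> 1" for f
  proof -
    have "?M f \<le> sqrt (energy X w p) * 1"
      using that energy_nonneg[of X w p]
      by (intro order_trans[OF weighted_square_mean_le[OF fin w]] mult_left_mono) auto
    moreover have "0 \<le> ?M f" using p0 by (intro sum_nonneg) auto
    ultimately have "(?M f)\<^sup>2 \<le> (sqrt (energy X w p))\<^sup>2" by (intro power_mono) auto
    then show ?thesis using energy_nonneg[of X w p] by simp
  qed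
  have sq: "(a - b - c)\<^sup>2 \<le> 3 * (a\<^sup>2 + b\<^sup>2 + c\<^sup>2)" for a b c :: real
  proof -
    have "3 * (a\<^sup>2 + b\<^sup>2 + c\<^sup>2) - (a - b - c)\<^sup>2 = (a + b)\<^sup>2 + (a + c)\<^sup>2 + (b - c)\<^sup>2"
      by (simp add: power2_eq_square algebra_simps)
    then show ?thesis
      using zero_le_power2[of "a + b"] zero_le_power2[of "a + c"] zero_le_power2[of "b - c"] by linarith
  qed
  have diag: "(\<Sum>y\<in>X. p y * (of_bool (x = y) / w x)\<^sup>2) = p x / (w x)\<^sup>2" if "x \<in> X" for x
  proof -
    have "(\<Sum>y\<in>X. p y * (of_bool (x = y) / w x)\<^sup>2) = (\<Sum>y\<in>X. if x = y then p y / (w y)\<^sup>2 else 0)"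
      by (intro sum.cong refl) (auto simp: power_divide)
    then show ?thesis using that fin by simp
  qed
  have rank1: "(\<Sum>x\<in>X. p x * (\<Sum>y\<in>X. p y * (f x / w x * (f y / w y))\<^sup>2)) = (?M f)\<^sup>2" for f
  proof -
    have "(\<Sum>x\<in>X. p x * (\<Sum>y\<in>X. p y * (f x / w x * (f y / w y))\<^sup>2))
        = (\<Sum>x\<in>X. \<Sum>y\<in>X. (p x * (f x / w x)\<^sup>2) * (p y * (f y / w y)\<^sup>2))"
      unfolding sum_distrib_left by (intro sum.cong refl) (simp add: power_mult_distrib power_divide)
    then show ?thesis by (simp only: power2_eq_square[of "?M f"] sum_product)
  qed
  have "(\<Sum>x\<in>X. p x * (\<Sum>y\<in>X. p y * (projection_kernel w u v x y)\<^sup>2))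
      \<le> (\<Sum>x\<in>X. p x * (\<Sum>y\<in>X. p y * (3 * ((of_bool (x = y) / w x)\<^sup>2
          + (u x / w x * (u y / w y))\<^sup>2 + (v x / w x * (v y / w y))\<^sup>2))))"
    unfolding projection_kernel_def by (intro sum_mono mult_left_mono sq p0)
  also have "\<dots> = 3 * ((\<Sum>x\<in>X. p x * (\<Sum>y\<in>X. p y * (of_bool (x = y) / w x)\<^sup>2))
      + (\<Sum>x\<in>X. p x * (\<Sum>y\<in>X. p y * (u x / w x * (u y / w y))\<^sup>2))
      + (\<Sum>x\<in>X. p x * (\<Sum>y\<in>X. p y * (v x / w x * (v y / w y))\<^sup>2)))"
    by (simp only: mult.left_commute[of _ 3] distrib_left sum.distrib flip: sum_distrib_left)
  also have "(\<Sum>x\<in>X. p x * (\<Sum>y\<in>X. p y * (of_bool (x = y) / w x)\<^sup>2)) = energy X w p"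
    unfolding energy_def by (intro sum.cong refl) (simp add: diag, simp add: power_divide power2_eq_square)
  also have "3 * (energy X w p + (\<Sum>x\<in>X. p x * (\<Sum>y\<in>X. p y * (u x / w x * (u y / w y))\<^sup>2))
      + (\<Sum>x\<in>X. p x * (\<Sum>y\<in>X. p y * (v x / w x * (v y / w y))\<^sup>2))) \<le> 9 * energy X w p"
  proof -
    have "wip X w u u \<le> 1" "wip X w v v \<le> 1"
      using on by (auto simp: orthonormal_pair_def wip_def)
    then show ?thesis unfolding rank1 using M[of u] M[of v] by simp
  qed
  finally show ?thesis .
qed

text \<open>Once the surplus factors \<open>1 / w x\<close> are replaced by their bound \<open>B\<close>, the energy alone controls the
variance of the collision count.\<close>

lemma collision_kernel_moments:
  assumes fin: "finite X" and w: "\<And>x. x \<in> X \<Longrightarrow> 0 < w x" and p0: "\<And>x. x \<in> X \<Longrightarrow> 0 \<le> p x"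
    and B: "\<And>x. x \<in> X \<Longrightarrow> 1 / w x \<le> B"
  shows "x \<in> X \<Longrightarrow> (\<Sum>y\<in>X. p y * collision_kernel w x y) = p x / (w x)\<^sup>2"
    and "(\<Sum>x\<in>X. p x * (p x / (w x)\<^sup>2)) = energy X w p"
    and "(\<Sum>x\<in>X. p x * (p x / (w x)\<^sup>2)\<^sup>2) \<le> B * sqrt (energy X w p) * energy X w p"
    and "(\<Sum>x\<in>X. p x * (\<Sum>y\<in>X. p y * (collision_kernel w x y)\<^sup>2)) \<le> B\<^sup>2 * energy X w p"
proof -
  have diag: "(\<Sum>y\<in>X. p y * (of_bool (x = y) * f x)) = p x * f x" if "x \<in> X" for x f
  proof -
    have "(\<Sum>y\<in>X. p y * (of_bool (x = y) * f x)) = (\<Sum>y\<in>X. if x = y then p y * f y else 0)"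
      by (intro sum.cong refl) auto
    then show ?thesis using that fin by simp
  qed
  show "x \<in> X \<Longrightarrow> (\<Sum>y\<in>X. p y * collision_kernel w x y) = p x / (w x)\<^sup>2"
    using diag[of x "\<lambda>x. 1 / (w x)\<^sup>2"] by (simp add: collision_kernel_def)
  show "(\<Sum>x\<in>X. p x * (p x / (w x)\<^sup>2)) = energy X w p"
    unfolding energy_def by (simp add: power_divide power2_eq_square)
  have "(\<Sum>x\<in>X. p x * (p x / (w x)\<^sup>2)\<^sup>2) = (\<Sum>x\<in>X. (1 / w x * (p x / w x)) * (p x / w x)\<^sup>2)"
    using w by (intro sum.cong refl) (simp add: power_divide power2_eq_square)
  also have "\<dots> \<le> (\<Sum>x\<in>X. (B * sqrt (energy X w p)) * (p x / w x)\<^sup>2)"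
  proof (intro sum_mono mult_right_mono mult_mono B ratio_le_sqrt_energy[OF fin])
    fix x assume x: "x \<in> X"
    have "0 \<le> 1 / w x" using w[OF x] by simp
    then show "0 \<le> B" using B[OF x] by linarith
    show "0 \<le> p x / w x" using w[OF x] p0[OF x] by simp
  qed auto
  finally show "(\<Sum>x\<in>X. p x * (p x / (w x)\<^sup>2)\<^sup>2) \<le> B * sqrt (energy X w p) * energy X w p"
    by (simp add: energy_def sum_distrib_left)
  have "(\<Sum>x\<in>X. p x * (\<Sum>y\<in>X. p y * (collision_kernel w x y)\<^sup>2)) = (\<Sum>x\<in>X. (1 / w x)\<^sup>2 * (p x / w x)\<^sup>2)"
  proof (intro sum.cong refl)
    fix x assume "x \<in> X"
    have "(\<Sum>y\<in>X. p y * (collision_kernel w x y)\<^sup>2) = (\<Sum>y\<in>X. p y * (of_bool (x = y) * (1 / (w x)\<^sup>2)\<^sup>2))"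
      by (intro sum.cong refl) (simp add: collision_kernel_def)
    then show "p x * (\<Sum>y\<in>X. p y * (collision_kernel w x y)\<^sup>2) = (1 / w x)\<^sup>2 * (p x / w x)\<^sup>2"
      using diag[OF \<open>x \<in> X\<close>, of "\<lambda>x. (1 / (w x)\<^sup>2)\<^sup>2"] by (simp add: power_divide power2_eq_square)
  qed
  also have "\<dots> \<le> (\<Sum>x\<in>X. B\<^sup>2 * (p x / w x)\<^sup>2)"
  proof (intro sum_mono mult_right_mono power_mono B)
    fix x assume "x \<in> X" then show "0 \<le> 1 / w x" using w by (simp add: less_imp_le)
  qed auto
  finally show "(\<Sum>x\<in>X. p x * (\<Sum>y\<in>X. p y * (collision_kernel w x y)\<^sup>2)) \<le> B\<^sup>2 * energy X w p"
    by (simp add: energy_def sum_distrib_left)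
qed

lemma collision_statistic_deviation:
  fixes X :: "'a set" and p w :: "'a \<Rightarrow> real"
  assumes fin: "finite X" and w: "\<And>x. x \<in> X \<Longrightarrow> 0 < w x" and B: "\<And>x. x \<in> X \<Longrightarrow> 1 / w x \<le> B"
    and p0: "\<And>x. x \<in> X \<Longrightarrow> 0 \<le> p x" and p1: "(\<Sum>x\<in>X. p x) = 1" and m: "2 \<le> m" and d: "0 < d"
  defines "N \<equiv> real m * (real m - 1) / 2" and "e \<equiv> energy X w p"
  shows "iid_mean X p m (\<lambda>xs. of_bool (N * d \<le> \<bar>pair_sum (collision_kernel w) xs - N * e\<bar>))
    \<le> 4 * (B\<^sup>2 * e) / (real m * d)\<^sup>2 + 8 * (B * sqrt e * e) / (real m * d\<^sup>2)"
  unfolding N_def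
proof (rule pair_sum_Chebyshev[where ?h1.0 = "\<lambda>x. p x / (w x)\<^sup>2"])
  show "collision_kernel w x y = collision_kernel w y x" for x y
    by (auto simp: collision_kernel_def)
  show "(\<Sum>y\<in>X. p y * collision_kernel w x y) = p x / (w x)\<^sup>2" if "x \<in> X" for x
    by (rule collision_kernel_moments(1)[OF fin _ _ _ that]) (rule w p0 B, assumption)+
  show "(\<Sum>x\<in>X. p x * (p x / (w x)\<^sup>2)) = e" unfolding e_def
    by (rule collision_kernel_moments(2)[OF fin]) (rule w p0 B, assumption)+
  show "(\<Sum>x\<in>X. p x * (p x / (w x)\<^sup>2)\<^sup>2) \<le> B * sqrt e * e" unfolding e_def
    by (rule collision_kernel_moments(3)[OF fin]) (rule w p0 B, assumption)+
  show "(\<Sum>x\<in>X. p x * (\<Sum>y\<in>X. p y * (collision_kernel w x y)\<^sup>2)) \<le> B\<^sup>2 * e" unfolding e_def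
    by (rule collision_kernel_moments(4)[OF fin]) (rule w p0 B, assumption)+
qed (use assms in auto)

lemma projection_statistic_deviation:
  fixes X :: "'a set" and p w u v :: "'a \<Rightarrow> real"
  assumes fin: "finite X" and w: "\<And>x. x \<in> X \<Longrightarrow> 0 < w x" and on: "orthonormal_pair X w u v"
    and p0: "\<And>x. x \<in> X \<Longrightarrow> 0 \<le> p x" and p1: "(\<Sum>x\<in>X. p x) = 1" and m: "2 \<le> m" and d: "0 < d"
  defines "N \<equiv> real m * (real m - 1) / 2" and "e \<equiv> energy X w p"
    and "\<theta> \<equiv> wip X w (residual X w u v p) (residual X w u v p)"
  shows "iid_mean X p m (\<lambda>xs. of_bool (N * d \<le> \<bar>pair_sum (projection_kernel w u v) xs - N * \<theta>\<bar>))
    \<le> 4 * (9 * e) / (real m * d)\<^sup>2 + 8 * (sqrt e * \<theta>) / (real m * d\<^sup>2)"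
  unfolding N_def
proof (rule pair_sum_Chebyshev[where ?h1.0 = "\<lambda>x. residual X w u v p x / w x"])
  show "projection_kernel w u v x y = projection_kernel w u v y x" for x y
    by (auto simp: projection_kernel_def mult.commute)
  show "(\<Sum>y\<in>X. p y * projection_kernel w u v x y) = residual X w u v p x / w x" if "x \<in> X" for x
    by (rule projection_kernel_mean[OF fin that])
  show "(\<Sum>x\<in>X. p x * (residual X w u v p x / w x)) = \<theta>"
    unfolding \<theta>_def wip_residual[OF on, symmetric] by (simp add: wip_def)
  show "(\<Sum>x\<in>X. p x * (residual X w u v p x / w x)\<^sup>2) \<le> sqrt e * \<theta>"
    unfolding e_def \<theta>_def by (rule weighted_square_mean_le[OF fin]) (rule w)
  show "(\<Sum>x\<in>X. p x * (\<Sum>y\<in>X. p y * (projection_kernel w u v x y)\<^sup>2)) \<le> 9 * e"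
    unfolding e_def by (rule projection_kernel_second_moment[OF fin _ _ on]) (rule w p0, assumption)+
qed (use assms in auto)

section \<open>From the plane to the segment\<close>

text \<open>Cauchy--Schwarz. For weights of bounded total the passage from the weighted \<open>l\<^sub>2\<close> norm to the \<open>l\<^sub>1\<close> norm
causes no loss that depends on the domain size.\<close>

lemma l1_le_weighted_l2:
  assumes w: "\<And>x. x \<in> X \<Longrightarrow> 0 < w x"
  shows "(\<Sum>x\<in>X. \<bar>g x\<bar>)\<^sup>2 \<le> (\<Sum>x\<in>X. w x) * wip X w g g"
proof -
  have "(\<Sum>x\<in>X. \<bar>g x\<bar>) = (\<Sum>x\<in>X. sqrt (w x) * (\<bar>g x\<bar> / sqrt (w x)))"
    using w by (intro sum.cong refl) (simp add: less_imp_neq[THEN not_sym])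
  then have "(\<Sum>x\<in>X. \<bar>g x\<bar>)\<^sup>2 \<le> (\<Sum>x\<in>X. (sqrt (w x))\<^sup>2) * (\<Sum>x\<in>X. (\<bar>g x\<bar> / sqrt (w x))\<^sup>2)"
    by (simp only: Cauchy_Schwarz_ineq_sum)
  also have "\<dots> = (\<Sum>x\<in>X. w x) * wip X w g g"
    unfolding wip_def using w
    by (intro arg_cong2[where f="(*)"] sum.cong refl) (auto simp: power_divide power2_eq_square less_imp_le)
  finally show ?thesis .
qed

text \<open>The projection statistic only sees the span of \<open>q1\<close> and \<open>q2\<close>, whereas the tester must recognise the
segment between them. A point close to the span is close to a point
\<open>q1 + \<gamma> (q2 - q1)\<close> of the line, because its coefficients add up to almost 1. If the point is far from
the segment then \<open>\<gamma>\<close> must lie outside \<open>[0, 1]\<close>, and the distance to the nearer end point shows up in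
the probability of the single event \<open>q2 < q1\<close>, on which \<open>q1\<close> and \<open>q2\<close> differ by half their
\<open>l\<^sub>1\<close> distance.\<close>

lemma far_from_segment_near_line:
  fixes p q1 q2 :: "'a \<Rightarrow> real"
  assumes fin: "finite X"
    and sums: "(\<Sum>x\<in>X. p x) = 1" "(\<Sum>x\<in>X. q1 x) = 1" "(\<Sum>x\<in>X. q2 x) = 1"
    and q0: "\<And>x. x \<in> X \<Longrightarrow> 0 \<le> q1 x"
    and near: "(\<Sum>x\<in>X. \<bar>p x - \<beta> * q1 x - \<gamma> * q2 x\<bar>) \<le> \<epsilon> / 12" and eps: "0 < \<epsilon>"
    and far: "\<And>\<alpha>. \<alpha> \<in> {0..1} \<Longrightarrow> \<epsilon> \<le> (\<Sum>x\<in>X. \<bar>p x - ((1 - \<alpha>) * q1 x + \<alpha> * q2 x)\<bar>)"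
  defines "A \<equiv> {x \<in> X. q2 x < q1 x}"
  shows "sum p A \<le> sum q2 A - \<epsilon> / 4 \<or> sum q1 A + \<epsilon> / 4 \<le> sum p A"
proof -
  define g where "g = (\<lambda>x. p x - \<beta> * q1 x - \<gamma> * q2 x)"
  \<comment> \<open>The error made when the coefficients of \<open>q1\<close> and \<open>q2\<close> are normalised to sum 1.\<close>
  define s where "s = sum g X"
  have s: "s = 1 - \<beta> - \<gamma>"
    using sums by (simp add: s_def g_def sum_subtractf flip: sum_distrib_left)
  define \<rho> where "\<rho> = (\<lambda>x. p x - (q1 x + \<gamma> * (q2 x - q1 x)))"
  have \<rho>: "\<rho> x = g x - s * q1 x" for x
    unfolding \<rho>_def g_def s by (simp add: algebra_simps)
  have "\<bar>s\<bar> \<le> (\<Sum>x\<in>X. \<bar>g x\<bar>)" unfolding s_def by (rule sum_abs)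
  then have sle: "\<bar>s\<bar> \<le> \<epsilon> / 12" using near unfolding g_def by linarith
  have "(\<Sum>x\<in>X. \<bar>\<rho> x\<bar>) \<le> (\<Sum>x\<in>X. \<bar>g x\<bar> + \<bar>s\<bar> * q1 x)"
  proof (rule sum_mono)
    fix x assume "x \<in> X"
    have "\<bar>\<rho> x\<bar> \<le> \<bar>g x\<bar> + \<bar>s * q1 x\<bar>" unfolding \<rho> by (rule abs_triangle_ineq4)
    then show "\<bar>\<rho> x\<bar> \<le> \<bar>g x\<bar> + \<bar>s\<bar> * q1 x" using q0[OF \<open>x \<in> X\<close>] by (simp add: abs_mult)
  qed
  also have "\<dots> = (\<Sum>x\<in>X. \<bar>g x\<bar>) + \<bar>s\<bar>"
    using sums by (simp add: sum.distrib flip: sum_distrib_left)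
  finally have \<rho>1: "(\<Sum>x\<in>X. \<bar>\<rho> x\<bar>) \<le> \<epsilon> / 6"
    using near sle unfolding g_def by linarith
  define D where "D = (\<Sum>x\<in>A. q1 x - q2 x)"
  have D: "D = sum q1 A - sum q2 A" by (simp add: D_def sum_subtractf)
  have D': "D = (\<Sum>x\<in>X. if q2 x < q1 x then q1 x - q2 x else 0)"
    unfolding D_def A_def by (rule sum.inter_filter[OF fin])
  have "(\<Sum>x\<in>X. \<bar>q1 x - q2 x\<bar>) = (\<Sum>x\<in>X. 2 * (if q2 x < q1 x then q1 x - q2 x else 0) - (q1 x - q2 x))"
    by (intro sum.cong refl) auto
  also have "\<dots> = 2 * D"
    using sums unfolding D' sum_subtractf sum_distrib_left[symmetric] by simp
  finally have l1: "(\<Sum>x\<in>X. \<bar>q1 x - q2 x\<bar>) = 2 * D" .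
  have "\<bar>sum \<rho> A\<bar> \<le> (\<Sum>x\<in>A. \<bar>\<rho> x\<bar>)" by (rule sum_abs)
  also have "\<dots> \<le> (\<Sum>x\<in>X. \<bar>\<rho> x\<bar>)" using fin by (intro sum_mono2) (auto simp: A_def)
  finally have \<rho>A: "\<bar>sum \<rho> A\<bar> \<le> \<epsilon> / 6" using \<rho>1 by linarith
  have pA: "sum p A = sum \<rho> A + sum q1 A - \<gamma> * D"
    by (simp add: \<rho>_def D sum_subtractf sum.distrib algebra_simps flip: sum_distrib_left)
  have beyond: "\<epsilon> \<le> \<epsilon> / 6 + \<bar>\<gamma> - \<alpha>\<bar> * (2 * D)" if "\<alpha> \<in> {0..1}" for \<alpha>
  proof -
    have "\<epsilon> \<le> (\<Sum>x\<in>X. \<bar>p x - ((1 - \<alpha>) * q1 x + \<alpha> * q2 x)\<bar>)" using far[OF that] .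
    also have "\<dots> \<le> (\<Sum>x\<in>X. \<bar>\<rho> x\<bar> + \<bar>\<gamma> - \<alpha>\<bar> * \<bar>q1 x - q2 x\<bar>)"
    proof (rule sum_mono)
      fix x
      have "p x - ((1 - \<alpha>) * q1 x + \<alpha> * q2 x) = \<rho> x - (\<gamma> - \<alpha>) * (q1 x - q2 x)"
        by (simp add: \<rho>_def algebra_simps)
      then show "\<bar>p x - ((1 - \<alpha>) * q1 x + \<alpha> * q2 x)\<bar> \<le> \<bar>\<rho> x\<bar> + \<bar>\<gamma> - \<alpha>\<bar> * \<bar>q1 x - q2 x\<bar>"
        unfolding abs_mult[symmetric] by (simp only: abs_triangle_ineq4)
    qed
    also have "\<dots> = (\<Sum>x\<in>X. \<bar>\<rho> x\<bar>) + \<bar>\<gamma> - \<alpha>\<bar> * (2 * D)"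
      by (simp add: sum.distrib l1 flip: sum_distrib_left)
    finally show ?thesis using \<rho>1 by linarith
  qed
  consider "\<gamma> < 0" | "0 \<le> \<gamma>" "\<gamma> \<le> 1" | "1 < \<gamma>" by linarith
  then show ?thesis
  proof cases
    case 1
    then have "\<epsilon> \<le> \<epsilon> / 6 - 2 * (\<gamma> * D)" using beyond[of 0] by simp
    then show ?thesis using pA \<rho>A by linarith
  next
    case 2
    then show ?thesis using beyond[of \<gamma>] eps by simp
  next
    case 3
    then have "\<epsilon> \<le> \<epsilon> / 6 + 2 * (\<gamma> * D) - 2 * D" using beyond[of 1] by (simp add: algebra_simps)
    then show ?thesis using pA \<rho>A D by linarith
  qed
qed

section \<open>The tester\<close>

text \<open>The tester accepts if three statistics are all within bounds. The collision statistic certifies that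
the energy is of the order it has for mixtures; the projection statistic, whose variance is
controlled by the energy, certifies closeness to the plane spanned by \<open>q1\<close> and \<open>q2\<close>; the number of
samples in the event \<open>q2 < q1\<close> certifies that the nearby point of the line is not beyond the end
points of the segment. A mixture fails each check with probability at most 1/9. A distribution that
is far from the segment has large energy, or lies far from the plane, or gives the event a
probability well outside the range between \<open>q2\<close> and \<open>q1\<close>; the corresponding check alone then rejects
it with probability at least 2/3.\<close>

lemma noise_tester_exists:
  fixes n m :: nat and \<epsilon> :: real
  assumes n: "1 \<le> n" and eps: "0 < \<epsilon>" "\<epsilon> \<le> 2"
    and q: "dist_on n q1" "dist_on n q2"
    and m: "10^6 * sqrt (real n) \<le> real m * \<epsilon>\<^sup>2"
  shows "\<exists>A. noise_identity_tester n q1 q2 \<epsilon> m A"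
proof -
  define X where "X = {1..n}"
  define r where "r = sqrt (real n)"
  have fin: "finite X" by (simp add: X_def)
  have r1: "1 \<le> r" and rr: "r\<^sup>2 = real n" and nr: "real n = r * r" using n by (simp_all add: r_def)
  have mr: "10^6 * r \<le> real m * \<epsilon>\<^sup>2" using m by (simp add: r_def)
  have "\<epsilon>\<^sup>2 \<le> 2\<^sup>2" using eps by (intro power_mono) auto
  then have "real m * \<epsilon>\<^sup>2 \<le> real m * 4" by (intro mult_left_mono) auto
  then have mr': "250000 * r \<le> real m" using mr by simp
  then have m2: "2 \<le> m" and mpos: "0 < real m" using r1 by auto
  have prob: "(\<Sum>x\<in>X. pmf P x) = 1" if "dist_on n P" for P
    using that fin unfolding dist_on_def X_def by (intro sum_pmf_eq_1) auto
  define w where "w = (\<lambda>x. pmf q1 x + pmf q2 x + 1 / real n)"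
  have wn: "1 / real n \<le> w x" for x by (simp add: w_def)
  have w: "0 < w x" for x using wn[of x] n by (smt (verit) of_nat_0_less_iff zero_less_divide_1_iff not_one_le_zero gr0I)
  have B: "1 / w x \<le> real n" for x using wn[of x] w[of x] n by (simp add: field_simps)
  have wsum: "(\<Sum>x\<in>X. w x) = 3"
    using prob[OF q(1)] prob[OF q(2)] n by (simp add: w_def sum.distrib) (simp add: X_def)
  have nz: "\<exists>x\<in>X. pmf q1 x \<noteq> 0"
    using prob[OF q(1)] by (metis sum.neutral zero_neq_one)
  obtain u v a b c a' b' c' where on: "orthonormal_pair X w u v"
    and qu: "\<And>x. x \<in> X \<Longrightarrow> pmf q1 x = a * u x" "\<And>x. x \<in> X \<Longrightarrow> pmf q2 x = b * u x + c * v x"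
    and uq: "\<And>x. u x = a' * pmf q1 x" "\<And>x. v x = b' * pmf q1 x + c' * pmf q2 x"
    by (rule Gram_Schmidt_pair[where ?q2.0 = "pmf q2", OF fin w nz]) (rule that, assumption+)
  define N where "N = real m * (real m - 1) / 2"
  have Npos: "0 < N" using m2 by (simp add: N_def)
  define A where "A = {x \<in> X. pmf q2 x < pmf q1 x}"
  have AX: "A \<subseteq> X" by (auto simp: A_def)
  \<comment> \<open>A residual of squared length below \<open>2 \<tau>\<close> has \<open>l\<^sub>1\<close> norm at most \<open>sqrt (3 * 2 \<tau>) = \<epsilon> / 12\<close>, since
    the weights add up to 3.\<close>
  define \<tau> where "\<tau> = \<epsilon>\<^sup>2 / 864"
  have \<tau>: "0 < \<tau>" using eps by (simp add: \<tau>_def)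
  define W0 where "W0 = pair_sum (collision_kernel w)"
  define W1 where "W1 = pair_sum (projection_kernel w u v)"
  define S where "S = (\<lambda>xs::nat list. \<Sum>x\<leftarrow>xs. of_bool (x \<in> A) :: real)"
  define ok where "ok = (\<lambda>xs. W0 xs < N * (2 * real n) \<and> W1 xs < N * \<tau> \<and>
    real m * (sum (pmf q2) A - \<epsilon> / 8) < S xs \<and> S xs < real m * (sum (pmf q1) A + \<epsilon> / 8))"
  define T where "T = (\<lambda>xs. return_pmf (if ok xs then Accept else Reject))"
  have okT: "pmf (T xs) Accept = of_bool (ok xs)" "pmf (T xs) Reject = of_bool (\<not> ok xs)" for xs
    by (simp_all add: T_def)
  have T: "pmf (run_on_samples T m P) Accept = iid_mean X (pmf P) m (\<lambda>xs. of_bool (ok xs))"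
    "pmf (run_on_samples T m P) Reject = iid_mean X (pmf P) m (\<lambda>xs. of_bool (\<not> ok xs))"
    if "dist_on n P" for P
    unfolding okT[symmetric] using that by (intro pmf_run_on_samples fin; simp add: dist_on_def X_def)+
  have D: "sum (pmf q2) A \<le> sum (pmf q1) A" unfolding A_def by (intro sum_mono) auto
  have "noise_identity_tester n q1 q2 \<epsilon> m T"
    unfolding noise_identity_tester_def
  proof (intro allI impI conjI)
    fix P assume P: "dist_on n P"
    define p where "p = pmf P"
    define e where "e = energy X w p"
    define \<theta> where "\<theta> = wip X w (residual X w u v p) (residual X w u v p)"
    let ?E = "iid_mean X p m"
    define bad0 where "bad0 = (\<lambda>d xs. of_bool (N * d \<le> \<bar>W0 xs - N * e\<bar>) :: real)"
    define bad1 where "bad1 = (\<lambda>d xs. of_bool (N * d \<le> \<bar>W1 xs - N * \<theta>\<bar>) :: real)"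
    define bad2 where "bad2 = (\<lambda>xs. of_bool (real m * (\<epsilon> / 8) \<le> \<bar>S xs - real m * sum p A\<bar>) :: real)"
    have p0: "0 \<le> p x" for x by (simp add: p_def)
    have p1: "(\<Sum>x\<in>X. p x) = 1" using prob[OF P] by (simp add: p_def)
    have e0: "0 \<le> e" unfolding e_def by (rule energy_nonneg)
    have bad0: "?E (bad0 d) \<le> 4 * ((real n)\<^sup>2 * e) / (real m * d)\<^sup>2 + 8 * (real n * sqrt e * e) / (real m * d\<^sup>2)"
      if "0 < d" for d
      unfolding bad0_def W0_def N_def e_def
      using fin w B p0 p1 m2 that by (intro collision_statistic_deviation) auto
    have bad1: "?E (bad1 d) \<le> 4 * (9 * e) / (real m * d)\<^sup>2 + 8 * (sqrt e * \<theta>) / (real m * d\<^sup>2)"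
      if "0 < d" for d
      unfolding bad1_def W1_def N_def e_def \<theta>_def
      using fin w on p0 p1 m2 that by (intro projection_statistic_deviation) auto
    have bad2: "?E bad2 \<le> 1/9"
    proof -
      have "(\<Sum>x\<in>X. p x * of_bool (x \<in> A)) = sum p A"
        using fin AX by (simp add: of_bool_def if_distrib sum.If_cases Int_absorb1 cong: if_cong)
      then have "?E bad2 \<le> 1 / (real m * (\<epsilon> / 8)\<^sup>2)"
        unfolding bad2_def S_def
        using sum_list_Chebyshev[of X p m "\<epsilon> / 8" "\<lambda>x. of_bool (x \<in> A)"] p0 p1 m2 eps by simp
      also have "\<dots> = 64 / (real m * \<epsilon>\<^sup>2)" by (simp add: power_divide)
      also have "\<dots> \<le> 64 / (10^6 * r)" using mr r1 by (intro divide_left_mono) auto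
      also have "\<dots> \<le> 1/9" using r1 by simp
      finally show ?thesis .
    qed
    \<comment> \<open>The factor \<open>10^6\<close> in the sample size makes quotients of this kind tiny; all deviation bounds below
      are quadratic polynomials in them.\<close>
    have ratio: "r / (real m * t) \<le> 1/1000" if "\<tau> \<le> t" for t
    proof -
      have "1000 * r \<le> real m * \<tau>" using mr r1 by (simp add: \<tau>_def)
      also have "\<dots> \<le> real m * t" using that by (intro mult_left_mono) auto
      finally show ?thesis using r1 by (simp add: field_simps)
    qed
    have ratio': "r / real m \<le> 1/1000" using mr' mpos by (simp add: field_simps)
    have r0: "0 \<le> r / (real m * t)" if "\<tau> \<le> t" for t using r1 that \<tau> by simp
    {
      assume "\<exists>\<alpha>\<in>{0..1}. pmf P = noisy_mixture \<alpha> q1 q2"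
      then obtain \<alpha> where \<alpha>: "0 \<le> \<alpha>" "\<alpha> \<le> 1" and pq: "p = noisy_mixture \<alpha> q1 q2"
        unfolding p_def by auto
      have px: "p x = (1 - \<alpha>) * pmf q1 x + \<alpha> * pmf q2 x" for x
        by (simp add: pq noisy_mixture_def)
      \<comment> \<open>The weights dominate \<open>q1 + q2\<close>, so every mixture is pointwise at most \<open>w\<close>.\<close>
      have en: "e \<le> real n"
      proof -
        have "(p x / w x)\<^sup>2 \<le> 1" for x
        proof -
          have "p x \<le> 1 * pmf q1 x + 1 * pmf q2 x"
            unfolding px using \<alpha> by (intro add_mono mult_right_mono) auto
          then have "p x \<le> w x" by (simp add: w_def add_increasing2)
          then show ?thesis using p0[of x] w[of x] by (simp add: power_le_one)
        qed
        then have "e \<le> (\<Sum>x\<in>X. 1)" unfolding e_def energy_def by (intro sum_mono)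
        then show ?thesis by (simp add: X_def)
      qed
      have se: "sqrt e \<le> r" unfolding r_def using en by simp
      have "residual X w u v p x = 0" if "x \<in> X" for x
      proof (rule residual_eq_0[OF on _ that])
        fix y assume "y \<in> X"
        then show "p y = ((1 - \<alpha>) * a + \<alpha> * b) * u y + (\<alpha> * c) * v y"
          by (simp add: px qu algebra_simps)
      qed
      then have \<theta>0: "\<theta> = 0" by (simp add: \<theta>_def wip_def)
      have b0: "?E (bad0 (real n)) \<le> 1/9"
      proof -
        have "?E (bad0 (real n)) \<le> 4 * ((real n)\<^sup>2 * e) / (real m * real n)\<^sup>2 + 8 * (real n * sqrt e * e) / (real m * (real n)\<^sup>2)"
          using n by (intro bad0) simp
        also have "\<dots> \<le> 4 * ((real n)\<^sup>2 * real n) / (real m * real n)\<^sup>2 + 8 * (real n * r * real n) / (real m * (real n)\<^sup>2)"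
          using en se e0 r1 by (intro add_mono divide_right_mono mult_left_mono mult_mono) auto
        also have "\<dots> = 4 * (r / real m)\<^sup>2 + 8 * (r / real m)"
          using r1 mpos unfolding nr by (simp add: field_simps power2_eq_square)
        also have "\<dots> \<le> 4 * (1/1000)\<^sup>2 + 8 * (1/1000)"
          using ratio' r1 by (intro add_mono mult_left_mono power_mono) auto
        finally show ?thesis by (simp add: power2_eq_square)
      qed
      have b1: "?E (bad1 \<tau>) \<le> 1/9"
      proof -
        have "?E (bad1 \<tau>) \<le> 4 * (9 * e) / (real m * \<tau>)\<^sup>2"
          using bad1[OF \<tau>] by (simp add: \<theta>0)
        also have "\<dots> \<le> 4 * (9 * real n) / (real m * \<tau>)\<^sup>2"
          using en by (intro divide_right_mono mult_left_mono) auto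
        also have "\<dots> = 36 * (r / (real m * \<tau>))\<^sup>2" by (simp add: power_divide rr)
        also have "\<dots> \<le> 36 * (1/1000)\<^sup>2"
          using ratio[of \<tau>] r0[of \<tau>] by (intro mult_left_mono power_mono) auto
        finally show ?thesis by (simp add: power2_eq_square)
      qed
      have pA: "sum p A = sum (pmf q1) A - \<alpha> * (sum (pmf q1) A - sum (pmf q2) A)"
        unfolding px sum.distrib sum_distrib_left[symmetric] by (simp add: algebra_simps)
      have le1: "sum p A \<le> sum (pmf q1) A" unfolding pA using \<alpha> D by simp
      have le2: "sum (pmf q2) A \<le> sum p A"
      proof -
        have "\<alpha> * (sum (pmf q1) A - sum (pmf q2) A) \<le> 1 * (sum (pmf q1) A - sum (pmf q2) A)"
          using \<alpha> D by (intro mult_right_mono) auto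
        then show ?thesis unfolding pA mult_1 by linarith
      qed
      have pt: "1 - (bad0 (real n) xs + (bad1 \<tau> xs + bad2 xs)) \<le> of_bool (ok xs)" for xs
      proof -
        have "ok xs" if "\<not> N * real n \<le> \<bar>W0 xs - N * e\<bar>" "\<not> N * \<tau> \<le> \<bar>W1 xs - N * \<theta>\<bar>"
          "\<not> real m * (\<epsilon> / 8) \<le> \<bar>S xs - real m * sum p A\<bar>"
        proof -
          have "N * e \<le> N * real n" "real m * sum p A \<le> real m * sum (pmf q1) A"
            "real m * sum (pmf q2) A \<le> real m * sum p A"
            using en Npos le1 le2 by (auto intro: mult_left_mono)
          moreover have "\<bar>W0 xs - N * e\<bar> < N * real n" "\<bar>W1 xs\<bar> < N * \<tau>"
              "\<bar>S xs - real m * sum p A\<bar> < real m * (\<epsilon> / 8)"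
            using that \<theta>0 by auto
          ultimately show ?thesis
            unfolding ok_def right_diff_distrib distrib_left by (intro conjI; linarith)
        qed
        then show ?thesis by (auto simp: bad0_def bad1_def bad2_def)
      qed
      have "2/3 \<le> 1 - (?E (bad0 (real n)) + (?E (bad1 \<tau>) + ?E bad2))" using b0 b1 bad2 by linarith
      also have "\<dots> = ?E (\<lambda>xs. 1 - (bad0 (real n) xs + (bad1 \<tau> xs + bad2 xs)))"
        by (simp add: iid_mean_diff iid_mean_add iid_mean_const[OF p1])
      also have "\<dots> \<le> ?E (\<lambda>xs. of_bool (ok xs))" using p0 by (intro iid_mean_mono pt)
      finally show "2/3 \<le> pmf (run_on_samples T m P) Accept" using T(1)[OF P] by (simp add: p_def)
    next
      assume far: "\<forall>\<alpha>\<in>{0..1}. \<epsilon> \<le> l1_dist n (pmf P) (noisy_mixture \<alpha> q1 q2)"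
      have reject: "2/3 \<le> pmf (run_on_samples T m P) Reject"
        if "?E bad \<le> 1/3" and "\<And>xs. \<not> B xs \<Longrightarrow> \<not> ok xs" and "bad = (\<lambda>xs. of_bool (B xs))" for bad B
      proof -
        have "2/3 \<le> 1 - ?E bad" using that(1) by linarith
        also have "\<dots> = ?E (\<lambda>xs. 1 - bad xs)" by (simp add: iid_mean_diff iid_mean_const[OF p1])
        also have "\<dots> \<le> ?E (\<lambda>xs. of_bool (\<not> ok xs))"
          using p0 that(2) by (intro iid_mean_mono) (auto simp: that(3))
        finally show ?thesis using T(2)[OF P] by (simp add: p_def)
      qed
      show "2/3 \<le> pmf (run_on_samples T m P) Reject"
      proof (cases "4 * real n \<le> e")
        case True
        have epos: "0 < e" using True n by simp
        have se: "2 * r \<le> sqrt e"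
          using True by (intro real_le_rsqrt) (simp add: power_mult_distrib rr)
        show ?thesis
        proof (rule reject[OF _ _ bad0_def[THEN fun_cong, of "e / 2"]])
          have "?E (bad0 (e / 2)) \<le> 4 * ((real n)\<^sup>2 * e) / (real m * (e / 2))\<^sup>2 + 8 * (real n * sqrt e * e) / (real m * (e / 2)\<^sup>2)"
            using epos by (intro bad0) simp
          also have "\<dots> = 16 * (real n)\<^sup>2 / ((real m)\<^sup>2 * e) + 32 * (real n * sqrt e) / (real m * e)"
            using epos mpos by (simp add: field_simps power2_eq_square)
          also have "32 * (real n * sqrt e) / (real m * e) = 32 * real n / (real m * sqrt e)"
            using epos mpos by (simp add: field_simps)
          also have "16 * (real n)\<^sup>2 / ((real m)\<^sup>2 * e) + 32 * real n / (real m * sqrt e)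
              \<le> 16 * (real n)\<^sup>2 / ((real m)\<^sup>2 * (4 * real n)) + 32 * real n / (real m * (2 * r))"
            using True epos se mpos r1 n by (intro add_mono divide_left_mono mult_left_mono) auto
          also have "\<dots> = 4 * (r / real m)\<^sup>2 + 16 * (r / real m)"
            using n r1 mpos unfolding nr by (simp add: field_simps power2_eq_square)
          also have "\<dots> \<le> 4 * (1/1000)\<^sup>2 + 16 * (1/1000)"
            using ratio' r1 by (intro add_mono mult_left_mono power_mono) auto
          finally show "?E (bad0 (e / 2)) \<le> 1/3" by (simp add: power2_eq_square)
        next
          fix xs assume "\<not> N * (e / 2) \<le> \<bar>W0 xs - N * e\<bar>"
          moreover have "N * (4 * real n) \<le> N * e" using True Npos by (intro mult_left_mono) auto
          ultimately show "\<not> ok xs" unfolding ok_def by (intro notI, elim conjE) linarith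
        qed
      next
        case False
        then have e4: "e \<le> 4 * real n" by simp
        have se: "sqrt e \<le> 2 * r"
          using e4 by (intro real_le_lsqrt) (use r1 e0 rr in \<open>auto simp: power_mult_distrib\<close>)
        show ?thesis
        proof (cases "2 * \<tau> \<le> \<theta>")
          case True
          have \<theta>pos: "0 < \<theta>" using True \<tau> by linarith
          show ?thesis
          proof (rule reject[OF _ _ bad1_def[THEN fun_cong, of "\<theta> / 2"]])
            have t: "\<tau> \<le> \<theta>" using True \<tau> by linarith
            have "?E (bad1 (\<theta> / 2)) \<le> 4 * (9 * e) / (real m * (\<theta> / 2))\<^sup>2 + 8 * (sqrt e * \<theta>) / (real m * (\<theta> / 2)\<^sup>2)"
              using \<theta>pos by (intro bad1) simp
            also have "\<dots> \<le> 4 * (9 * (4 * real n)) / (real m * (\<theta> / 2))\<^sup>2 + 8 * (2 * r * \<theta>) / (real m * (\<theta> / 2)\<^sup>2)"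
              using e4 se \<theta>pos by (intro add_mono divide_right_mono mult_left_mono mult_right_mono) auto
            also have "\<dots> = 576 * (r / (real m * \<theta>))\<^sup>2 + 64 * (r / (real m * \<theta>))"
              using \<theta>pos mpos unfolding nr by (simp add: field_simps power2_eq_square)
            also have "\<dots> \<le> 576 * (1/1000)\<^sup>2 + 64 * (1/1000)"
              using ratio[OF t] r0[OF t] by (intro add_mono mult_left_mono power_mono) auto
            finally show "?E (bad1 (\<theta> / 2)) \<le> 1/3" by (simp add: power2_eq_square)
          next
            fix xs assume "\<not> N * (\<theta> / 2) \<le> \<bar>W1 xs - N * \<theta>\<bar>"
            moreover have "N * (2 * \<tau>) \<le> N * \<theta>" using True Npos by (intro mult_left_mono) auto
            ultimately show "\<not> ok xs" unfolding ok_def by (intro notI, elim conjE) linarith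
          qed
        next
          case False
          let ?g = "residual X w u v p"
          have "(\<Sum>x\<in>X. \<bar>?g x\<bar>)\<^sup>2 \<le> 3 * \<theta>"
            unfolding \<theta>_def wsum[symmetric] using w by (intro l1_le_weighted_l2)
          also have "\<dots> \<le> (\<epsilon> / 12)\<^sup>2" using False by (simp add: \<tau>_def power_divide)
          finally have g: "(\<Sum>x\<in>X. \<bar>?g x\<bar>) \<le> \<epsilon> / 12"
            by (rule power2_le_imp_le) (use eps in simp)
          \<comment> \<open>The basis vectors are combinations of \<open>q1\<close> and \<open>q2\<close>, so the residual is the difference
            between \<open>p\<close> and an explicit element of their span.\<close>
          define \<beta> where "\<beta> = wip X w p u * a' + wip X w p v * b'"
          define \<gamma> where "\<gamma> = wip X w p v * c'"
          have "?g x = p x - \<beta> * pmf q1 x - \<gamma> * pmf q2 x" for x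
            unfolding residual_def uq[of x] \<beta>_def \<gamma>_def by (simp add: algebra_simps)
          then have near: "(\<Sum>x\<in>X. \<bar>p x - \<beta> * pmf q1 x - \<gamma> * pmf q2 x\<bar>) \<le> \<epsilon> / 12"
            using g by simp
          have far': "\<epsilon> \<le> (\<Sum>x\<in>X. \<bar>p x - ((1 - \<alpha>) * pmf q1 x + \<alpha> * pmf q2 x)\<bar>)" if "\<alpha> \<in> {0..1}" for \<alpha>
            using far that by (simp add: l1_dist_def noisy_mixture_def p_def X_def)
          have out: "sum p A \<le> sum (pmf q2) A - \<epsilon> / 4 \<or> sum (pmf q1) A + \<epsilon> / 4 \<le> sum p A"
            unfolding A_def
            using far_from_segment_near_line[OF fin p1 prob[OF q(1)] prob[OF q(2)] _ near eps(1) far'] by simp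
          show ?thesis
          proof (rule reject[OF _ _ bad2_def])
            show "?E bad2 \<le> 1/3" using bad2 by linarith
          next
            fix xs assume dev: "\<not> real m * (\<epsilon> / 8) \<le> \<bar>S xs - real m * sum p A\<bar>"
            from out show "\<not> ok xs"
            proof
              assume "sum p A \<le> sum (pmf q2) A - \<epsilon> / 4"
              then have "real m * sum p A \<le> real m * (sum (pmf q2) A - \<epsilon> / 4)" by (intro mult_left_mono) auto
              then show ?thesis using dev unfolding ok_def right_diff_distrib distrib_left by (intro notI, elim conjE) linarith
            next
              assume "sum (pmf q1) A + \<epsilon> / 4 \<le> sum p A"
              then have "real m * (sum (pmf q1) A + \<epsilon> / 4) \<le> real m * sum p A" by (intro mult_left_mono) auto
              then show ?thesis using dev unfolding ok_def right_diff_distrib distrib_left by (intro notI, elim conjE) linarith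
            qed
          qed
        qed
      qed
    }
  qed
  then show ?thesis by blast
qed

text \<open>The \<open>l\<^sub>1\<close> distance of two distributions is at most 2, so for larger \<open>\<epsilon>\<close> nothing is to be rejected.\<close>

lemma noise_identity_tester_no_samples:
  assumes eps: "2 < \<epsilon>" and q1: "dist_on n q1"
  shows "noise_identity_tester n q1 q2 \<epsilon> 0 (\<lambda>_. return_pmf Accept)"
proof -
  have "\<not> (\<forall>\<alpha>\<in>{0..1}. \<epsilon> \<le> l1_dist n (pmf p) (noisy_mixture \<alpha> q1 q2))" if "dist_on n p" for p
  proof -
    have "l1_dist n (pmf p) (noisy_mixture 0 q1 q2) \<le> (\<Sum>i=1..n. pmf p i + pmf q1 i)"
      unfolding l1_dist_def noisy_mixture_def
      by (intro sum_mono) (auto simp: abs_le_iff intro: add_increasing add_increasing2)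
    also have "\<dots> = 2"
      using that q1 unfolding dist_on_def sum.distrib
      by (subst (1 2) sum_pmf_eq_1) auto
    finally show ?thesis using eps by (intro notI) (drule bspec[of _ _ 0], auto)
  qed
  then show ?thesis
    by (auto simp: noise_identity_tester_def run_on_samples_def bind_return_pmf)
qed

text \<open>Rounding the number of samples up costs at most 1, which is at most \<open>4 sqrt n / \<epsilon>\<^sup>2\<close> for
\<open>\<epsilon> \<le> 2\<close>; this is the additive 4 in the constant.\<close>

lemma testing_upper_bound:
  fixes n :: nat and \<epsilon> :: real
  assumes n: "1 \<le> n" and eps: "0 < \<epsilon>" and q: "dist_on n q1" "dist_on n q2"
  shows "\<exists>m A. real m \<le> (10^6 + 4) * sqrt (real n) / \<epsilon>\<^sup>2 \<and> noise_identity_tester n q1 q2 \<epsilon> m A"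
proof (cases "\<epsilon> \<le> 2")
  case True
  define m where "m = nat \<lceil>10^6 * sqrt (real n) / \<epsilon>\<^sup>2\<rceil>"
  have ge: "10^6 * sqrt (real n) / \<epsilon>\<^sup>2 \<le> real m"
    unfolding m_def by (rule real_nat_ceiling_ge)
  then have "10^6 * sqrt (real n) \<le> real m * \<epsilon>\<^sup>2" using eps by (simp add: field_simps)
  then obtain A where "noise_identity_tester n q1 q2 \<epsilon> m A"
    using noise_tester_exists[OF n eps True q] by blast
  moreover have "real m \<le> (10^6 + 4) * sqrt (real n) / \<epsilon>\<^sup>2"
  proof -
    have "real m \<le> 10^6 * sqrt (real n) / \<epsilon>\<^sup>2 + 1"
      using of_int_ceiling_le_add_one[of "10^6 * sqrt (real n) / \<epsilon>\<^sup>2"] by (simp add: m_def)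
    moreover have "1 \<le> 4 * sqrt (real n) / \<epsilon>\<^sup>2"
    proof -
      have "\<epsilon>\<^sup>2 \<le> 4" using power_mono[of \<epsilon> 2 2] eps True by simp
      moreover have "1 \<le> sqrt (real n)" using n by simp
      ultimately have "\<epsilon>\<^sup>2 \<le> 4 * sqrt (real n)" by linarith
      then show ?thesis using eps by simp
    qed
    ultimately show ?thesis by (simp add: distrib_right add_divide_distrib)
  qed
  ultimately show ?thesis by blast
next
  case False
  then have "noise_identity_tester n q1 q2 \<epsilon> 0 (\<lambda>_. return_pmf Accept)"
    using q by (intro noise_identity_tester_no_samples) auto
  then show ?thesis
    by (intro exI[of _ 0] exI[of _ "\<lambda>_. return_pmf Accept"]) auto
qed

section \<open>The lower bound\<close>

text \<open>The moment generating function of a uniform sign, read off from the function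
estimate behind Hoeffding's lemma at the symmetric two-point distribution on \<open>{0, 2 c}\<close>.\<close>

lemma cosh_le_exp_half_square:
  fixes c :: real
  assumes "0 \<le> c"
  shows "(exp c + exp (- c)) / 2 \<le> exp (c\<^sup>2 / 2)"
proof -
  have pos: "0 < 1 + 1/2 * (exp (2 * c) - 1)"
    by (simp add: field_simps add_pos_pos)
  have "- (2 * c) * (1/2) + ln (1 + 1/2 * (exp (2 * c) - 1)) \<le> (2 * c)\<^sup>2 / 8"
    using assms by (intro Hoeffdings_lemma_aux) auto
  then have "exp (- c + ln (1 + 1/2 * (exp (2 * c) - 1))) \<le> exp (c\<^sup>2 / 2)"
    by (simp add: power_mult_distrib)
  moreover have "exp (- c + ln (1 + 1/2 * (exp (2 * c) - 1))) = (exp c + exp (- c)) / 2"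
  proof -
    have "exp (- c + ln (1 + 1/2 * (exp (2 * c) - 1))) = exp (- c) * (1 + 1/2 * (exp (2 * c) - 1))"
      by (simp only: exp_add exp_ln[OF pos])
    moreover have "exp (- c) * exp (2 * c) = exp c" by (simp flip: exp_add)
    ultimately show ?thesis by (simp add: algebra_simps)
  qed
  ultimately show ?thesis by (simp only:)
qed

definition sign_vectors :: "nat \<Rightarrow> (nat \<Rightarrow> real) set" where
  "sign_vectors k = {1..k} \<rightarrow>\<^sub>E {-1, 1}"

lemma finite_sign_vectors: "finite (sign_vectors k)"
  unfolding sign_vectors_def by (intro finite_PiE) auto

lemma card_sign_vectors: "card (sign_vectors k) = 2 ^ k"
  by (simp add: sign_vectors_def card_PiE numeral_2_eq_2)

lemma sign_vectors_value: "z \<in> sign_vectors k \<Longrightarrow> i \<in> {1..k} \<Longrightarrow> z i = - 1 \<or> z i = 1"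
  by (auto simp: sign_vectors_def PiE_iff)

text \<open>The product of two independent uniform sign vectors is again a uniform sign vector, whatever the
first of them is; so the sum factorises into hyperbolic cosines.\<close>

lemma sum_sign_vectors_exp:
  assumes z: "z \<in> sign_vectors k" and c: "0 \<le> c"
  shows "(\<Sum>z'\<in>sign_vectors k. exp (c * (\<Sum>i=1..k. z i * z' i))) \<le> 2 ^ k * exp (c\<^sup>2 * k / 2)"
proof -
  have "(\<Sum>z'\<in>sign_vectors k. exp (c * (\<Sum>i=1..k. z i * z' i)))
      = (\<Sum>z'\<in>sign_vectors k. \<Prod>i\<in>{1..k}. exp (c * z i * z' i))"
    by (simp add: exp_sum sum_distrib_left mult.assoc)
  also have "\<dots> = (\<Prod>i\<in>{1..k}. \<Sum>y\<in>{-1, 1}. exp (c * z i * y))"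
    unfolding sign_vectors_def by (intro prod_sum_PiE[symmetric]) auto
  also have "\<dots> \<le> (\<Prod>i\<in>{1..k}. 2 * exp (c\<^sup>2 / 2))"
  proof (rule prod_mono)
    fix i assume "i \<in> {1..k}"
    then have "z i = - 1 \<or> z i = 1" using z by (intro sign_vectors_value)
    then have "(\<Sum>y\<in>{-1, 1}. exp (c * z i * y)) = exp c + exp (- c)" by auto
    then show "0 \<le> (\<Sum>y\<in>{-1, 1}. exp (c * z i * y)) \<and>
        (\<Sum>y\<in>{-1, 1}. exp (c * z i * y)) \<le> 2 * exp (c\<^sup>2 / 2)"
      using cosh_le_exp_half_square[OF c] by simp
  qed
  also have "\<dots> = 2 ^ k * exp (c\<^sup>2 * k / 2)"
    by (simp add: power_mult_distrib exp_of_nat_mult[symmetric] mult.commute)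
  finally show ?thesis .
qed

text \<open>Elements \<open>i\<close> and \<open>i + k\<close> of the domain are perturbed in opposite directions, so that the total mass
stays 1 for every sign vector.\<close>

definition pair_sign :: "nat \<Rightarrow> (nat \<Rightarrow> real) \<Rightarrow> nat \<Rightarrow> real" where
  "pair_sign k z x = (if x \<le> k then z x else - z (x - k))"

lemma sum_double_interval:
  fixes f :: "nat \<Rightarrow> real"
  shows "(\<Sum>x=1..2*k. f x) = (\<Sum>i=1..k. f i + f (i + k))"
proof -
  have "{1..2*k} = {1..k} \<union> {1+k..k+k}" "{1..k} \<inter> {1+k..k+k} = {}" by auto
  then have "(\<Sum>x=1..2*k. f x) = (\<Sum>x=1..k. f x) + (\<Sum>x=1+k..k+k. f x)"
    by (simp add: sum.union_disjoint)
  also have "(\<Sum>x=1+k..k+k. f x) = (\<Sum>i=1..k. f (i + k))"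
    by (rule sum.shift_bounds_cl_nat_ivl)
  finally show ?thesis by (simp add: sum.distrib)
qed

lemma sum_pair_sign: "(\<Sum>x=1..2*k. pair_sign k z x) = 0"
  unfolding sum_double_interval by (intro sum.neutral) (auto simp: pair_sign_def)

lemma sum_pair_sign_mult: "(\<Sum>x=1..2*k. pair_sign k z x * pair_sign k z' x) = 2 * (\<Sum>i=1..k. z i * z' i)"
  unfolding sum_double_interval sum_distrib_left by (intro sum.cong refl) (auto simp: pair_sign_def)

lemma pair_sign_value:
  "z \<in> sign_vectors k \<Longrightarrow> x \<in> {1..2*k} \<Longrightarrow> pair_sign k z x = - 1 \<or> pair_sign k z x = 1"
  using sign_vectors_value[of z k x] sign_vectors_value[of z k "x - k"]
  by (cases "x \<le> k") (force simp: pair_sign_def)+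

lemma ex_pmf_finite_support:
  fixes f :: "nat \<Rightarrow> real"
  assumes "finite X" "\<And>x. x \<in> X \<Longrightarrow> 0 \<le> f x" "(\<Sum>x\<in>X. f x) = 1"
  obtains P where "pmf P = (\<lambda>x. if x \<in> X then f x else 0)"
proof
  let ?f = "\<lambda>x. if x \<in> X then f x else 0"
  have "(\<integral>\<^sup>+x. ennreal (?f x) \<partial>count_space UNIV) = (\<Sum>x\<in>X. ennreal (?f x))"
    using assms(1) by (intro nn_integral_count_space') auto
  also have "\<dots> = ennreal (\<Sum>x\<in>X. ?f x)"
    using assms by (intro sum_ennreal) auto
  finally have "(\<integral>\<^sup>+x. ennreal (?f x) \<partial>count_space UNIV) = 1"
    using assms by simp
  then show "pmf (embed_pmf ?f) = ?f"
    using assms by (intro ext pmf_embed_pmf) auto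
qed

lemma iid_mean_change_of_measure:
  "iid_mean X (\<lambda>x. p x * l x) m f = iid_mean X p m (\<lambda>xs. (\<Prod>x\<leftarrow>xs. l x) * f xs)"
  by (induction m arbitrary: f) (simp_all add: iid_mean_cmult mult.assoc)

lemma iid_mean_prod_list: "iid_mean X p m (\<lambda>xs. \<Prod>x\<leftarrow>xs. l x) = (\<Sum>x\<in>X. p x * l x) ^ m"
  by (induction m) (simp_all add: iid_mean_cmult mult.assoc[symmetric] flip: sum_distrib_right)

lemma prod_list_map_mult:
  "(\<Prod>x\<leftarrow>xs. f x * g x :: real) = (\<Prod>x\<leftarrow>xs. f x) * (\<Prod>x\<leftarrow>xs. g x)"
  by (induction xs) simp_all

text \<open>Le Cam's two-point method with the chi-square divergence, where the alternative is a uniformly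
chosen member of a family. The average likelihood ratio \<open>\<Lambda> / K\<close> has mean 1, and a test that separates
the base measure from the family must see the deviation of this ratio from 1; hence its variance,
which is the quantity on the right divided by \<open>(card Z)\<^sup>2\<close>, minus 1, is at least 1/9. The right-hand side
factorises over the samples, which is what makes the method usable.\<close>

lemma mixture_second_moment_lower_bound:
  fixes u :: "'a \<Rightarrow> real" and L :: "'b \<Rightarrow> 'a \<Rightarrow> real"
  assumes fin: "finite Z" "Z \<noteq> {}" and u0: "\<And>x. x \<in> X \<Longrightarrow> 0 \<le> u x" and u1: "(\<Sum>x\<in>X. u x) = 1"
    and L1: "\<And>z. z \<in> Z \<Longrightarrow> (\<Sum>x\<in>X. u x * L z x) = 1"
    and f: "\<And>xs. 0 \<le> f xs" "\<And>xs. f xs \<le> 1"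
    and acc: "2/3 \<le> iid_mean X u m f"
    and rej: "\<And>z. z \<in> Z \<Longrightarrow> iid_mean X (\<lambda>x. u x * L z x) m f \<le> 1/3"
  shows "10/9 * (real (card Z))\<^sup>2 \<le> (\<Sum>z\<in>Z. \<Sum>z'\<in>Z. (\<Sum>x\<in>X. u x * (L z x * L z' x)) ^ m)"
proof -
  define K where "K = real (card Z)"
  have K: "K > 0" using fin by (simp add: K_def card_gt_0_iff)
  define \<Lambda> where "\<Lambda> = (\<lambda>xs. \<Sum>z\<in>Z. (\<Prod>x\<leftarrow>xs. L z x))"
  let ?E = "iid_mean X u m"
  have E\<Lambda>: "?E \<Lambda> = K"
    unfolding \<Lambda>_def by (simp add: iid_mean_sum iid_mean_prod_list L1 K_def)
  have E\<Lambda>f: "?E (\<lambda>xs. \<Lambda> xs * f xs) \<le> K * (1/3)"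
  proof -
    have "?E (\<lambda>xs. \<Lambda> xs * f xs) = (\<Sum>z\<in>Z. iid_mean X (\<lambda>x. u x * L z x) m f)"
      unfolding \<Lambda>_def by (simp add: sum_distrib_right iid_mean_sum iid_mean_change_of_measure)
    also have "\<dots> \<le> (\<Sum>z\<in>Z. 1/3)" by (intro sum_mono rej)
    finally show ?thesis by (simp add: K_def)
  qed
  have E2: "?E (\<lambda>xs. \<Lambda> xs * \<Lambda> xs) = (\<Sum>z\<in>Z. \<Sum>z'\<in>Z. (\<Sum>x\<in>X. u x * (L z x * L z' x)) ^ m)"
    unfolding \<Lambda>_def
    by (simp add: sum_product iid_mean_sum iid_mean_prod_list flip: prod_list_map_mult)
  \<comment> \<open>The inequality \<open>2 a b \<le> a\<^sup>2 + b\<^sup>2\<close> for \<open>a = f xs / 3\<close> and \<open>b = 1 - \<Lambda> xs / K\<close>, cleared of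
    denominators; it replaces Cauchy--Schwarz, and the scale 1/3 is optimal for the gap 2/3 - 1/3.\<close>
  have pt: "K * (K * f xs - \<Lambda> xs * f xs) \<le> K\<^sup>2 * (1/6) + 3/2 * (K\<^sup>2 - 2 * K * \<Lambda> xs + \<Lambda> xs * \<Lambda> xs)" for xs
  proof -
    have "K * (K * f xs - \<Lambda> xs * f xs) = (K * f xs) * (K - \<Lambda> xs)" by (simp add: algebra_simps)
    also have "\<dots> \<le> (K * f xs)\<^sup>2 * (1/6) + 3/2 * (K - \<Lambda> xs)\<^sup>2"
    proof -
      have "(K * f xs)\<^sup>2 * (1/6) + 3/2 * (K - \<Lambda> xs)\<^sup>2 - (K * f xs) * (K - \<Lambda> xs)
          = 3/2 * (K * f xs / 3 - (K - \<Lambda> xs))\<^sup>2"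
        by (simp add: power2_eq_square algebra_simps)
      moreover have "0 \<le> 3/2 * (K * f xs / 3 - (K - \<Lambda> xs))\<^sup>2" by simp
      ultimately show ?thesis by linarith
    qed
    also have "(K * f xs)\<^sup>2 * (1/6) \<le> K\<^sup>2 * (1/6)"
      using f[of xs] K by (intro mult_right_mono power_mono) (auto simp: mult_left_le)
    finally show ?thesis by (simp add: power2_eq_square algebra_simps)
  qed
  have "K * (K * ?E f - ?E (\<lambda>xs. \<Lambda> xs * f xs)) = ?E (\<lambda>xs. K * (K * f xs - \<Lambda> xs * f xs))"
    by (simp add: iid_mean_cmult iid_mean_diff)
  also have "\<dots> \<le> ?E (\<lambda>xs. K\<^sup>2 * (1/6) + 3/2 * (K\<^sup>2 - 2 * K * \<Lambda> xs + \<Lambda> xs * \<Lambda> xs))"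
    using u0 by (intro iid_mean_mono pt)
  also have "\<dots> = K\<^sup>2 * (1/6) + 3/2 * (K\<^sup>2 - 2 * K * ?E \<Lambda> + ?E (\<lambda>xs. \<Lambda> xs * \<Lambda> xs))"
    by (simp only: iid_mean_add iid_mean_diff iid_mean_cmult iid_mean_const[OF u1])
  finally have "K * (K * ?E f - ?E (\<lambda>xs. \<Lambda> xs * f xs))
      \<le> K\<^sup>2 * (1/6) + 3/2 * (K\<^sup>2 - 2 * K * K + ?E (\<lambda>xs. \<Lambda> xs * \<Lambda> xs))"
    unfolding E\<Lambda> .
  moreover have "K * (K * (2/3) - K * (1/3)) \<le> K * (K * ?E f - ?E (\<lambda>xs. \<Lambda> xs * f xs))"
    using K acc E\<Lambda>f by (intro mult_left_mono diff_mono) auto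
  ultimately have "10/9 * K\<^sup>2 \<le> ?E (\<lambda>xs. \<Lambda> xs * \<Lambda> xs)"
    by (simp add: power2_eq_square algebra_simps)
  then show ?thesis unfolding E2 K_def .
qed

text \<open>Testing uniformity is the special case of equal known distributions. The alternatives multiply each
probability by \<open>1 \<plusminus> \<epsilon>\<close>, so all have distance \<open>\<epsilon>\<close> from uniform. Two of them, with sign
vectors \<open>z\<close> and \<open>z'\<close>, have correlation \<open>\<epsilon>\<^sup>2\<close> times the normalised inner product of \<open>z\<close> and \<open>z'\<close>, which
is typically of order \<open>1 / sqrt k\<close>; only after about \<open>sqrt k / \<epsilon>\<^sup>2\<close> samples does the accumulated
correlation become noticeable.\<close>

lemma uniformity_lower_bound:
  fixes \<epsilon> :: real
  assumes k: "1 \<le> k" and n: "2 * k \<le> n" and eps: "0 < \<epsilon>" "\<epsilon> \<le> 1"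
    and tester: "noise_identity_tester n (pmf_of_set {1..2*k}) (pmf_of_set {1..2*k}) \<epsilon> m A"
  shows "real k / 5 \<le> (real m * \<epsilon>\<^sup>2)\<^sup>2"
proof -
  let ?X = "{1..2*k}" and ?Z = "sign_vectors k"
  define u where "u = (\<lambda>x::nat. 1 / (2 * real k))"
  define L where "L = (\<lambda>z x. 1 + \<epsilon> * pair_sign k z x)"
  define U where "U = pmf_of_set ?X"
  define f where "f = (\<lambda>xs. pmf (A xs) Accept)"
  have U: "pmf U x = (if x \<in> ?X then u x else 0)" for x
    using k by (auto simp: U_def u_def pmf_of_set indicator_def)
  have mix: "noisy_mixture \<alpha> U U = pmf U" for \<alpha>
    by (auto simp: noisy_mixture_def algebra_simps)
  have setU: "set_pmf U \<subseteq> ?X" using k by (simp add: U_def)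
  have run: "pmf (run_on_samples A m P) Accept = iid_mean ?X g m f"
    if "pmf P = (\<lambda>x. if x \<in> ?X then g x else 0)" for P g
  proof -
    have "set_pmf P \<subseteq> ?X" by (auto simp: set_pmf_eq that split: if_splits)
    then have "pmf (run_on_samples A m P) Accept = iid_mean ?X (pmf P) m f"
      unfolding f_def by (intro pmf_run_on_samples) auto
    also have "iid_mean ?X (pmf P) m f' = iid_mean ?X g m f'" for f'
      by (induction m arbitrary: f') (simp_all add: that)
    finally show ?thesis .
  qed
  have T: "dist_on n P \<Longrightarrow> ((\<exists>\<alpha>\<in>{0..1}. pmf P = noisy_mixture \<alpha> U U) \<longrightarrow>
           pmf (run_on_samples A m P) Accept \<ge> 2/3) \<and>
        ((\<forall>\<alpha>\<in>{0..1}. l1_dist n (pmf P) (noisy_mixture \<alpha> U U) \<ge> \<epsilon>) \<longrightarrow>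
           pmf (run_on_samples A m P) Reject \<ge> 2/3)" for P
    using tester unfolding noise_identity_tester_def U_def by blast
  have acc: "2/3 \<le> iid_mean ?X u m f"
  proof -
    have "dist_on n U" using setU n unfolding dist_on_def by force
    then have "2/3 \<le> pmf (run_on_samples A m U) Accept"
      using T[of U] unfolding mix by (auto intro!: bexI[of _ 0])
    then show ?thesis using run[of U u, OF ext[OF U]] by simp
  qed
  have uL: "(\<Sum>x\<in>?X. u x * L z x) = 1" for z
  proof -
    have "(\<Sum>x\<in>?X. u x * L z x) = (\<Sum>x\<in>?X. u x) + (\<epsilon> / (2 * real k)) * (\<Sum>x\<in>?X. pair_sign k z x)"
      by (simp add: u_def L_def sum.distrib sum_distrib_left add_divide_distrib flip: sum_divide_distrib)
    then show ?thesis using k unfolding sum_pair_sign by (simp add: u_def)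
  qed
  have L0: "0 \<le> L z x" if "z \<in> ?Z" "x \<in> ?X" for z x
    using pair_sign_value[OF that] eps by (auto simp: L_def)
  have rej: "iid_mean ?X (\<lambda>x. u x * L z x) m f \<le> 1/3" if z: "z \<in> ?Z" for z
  proof -
    obtain P where P: "pmf P = (\<lambda>x. if x \<in> ?X then u x * L z x else 0)"
      using uL[of z] L0[OF z] by (elim ex_pmf_finite_support[rotated 2]) (auto simp: u_def)
    have "dist_on n P"
      using n by (auto simp: dist_on_def set_pmf_eq P split: if_splits)
    moreover have "\<epsilon> \<le> l1_dist n (pmf P) (pmf U)"
    proof -
      have "\<epsilon> = (\<Sum>x\<in>?X. \<epsilon> / (2 * real k))" using k by simp
      also have "\<dots> = (\<Sum>x\<in>?X. \<bar>pmf P x - pmf U x\<bar>)"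
      proof (intro sum.cong refl)
        fix x assume x: "x \<in> ?X"
        have "pmf P x - pmf U x = \<epsilon> / (2 * real k) * pair_sign k z x"
          using x by (simp add: P U u_def L_def diff_divide_distrib[symmetric])
        then show "\<epsilon> / (2 * real k) = \<bar>pmf P x - pmf U x\<bar>"
          using pair_sign_value[OF z x] eps by (auto simp: abs_mult)
      qed
      also have "\<dots> \<le> l1_dist n (pmf P) (pmf U)"
        unfolding l1_dist_def using n by (intro sum_mono2) auto
      finally show ?thesis .
    qed
    ultimately have "2/3 \<le> pmf (run_on_samples A m P) Reject"
      using T[of P] unfolding mix by auto
    moreover have "pmf (run_on_samples A m P) Accept + pmf (run_on_samples A m P) Reject = 1"
      (is "pmf ?Q _ + _ = _")
    proof -
      have "set_pmf ?Q \<subseteq> {Accept, Reject}" using verdict.exhaust by blast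
      then have "(\<Sum>v\<in>{Accept, Reject}. pmf ?Q v) = 1" by (intro sum_pmf_eq_1) simp_all
      then show ?thesis by simp
    qed
    ultimately have "pmf (run_on_samples A m P) Accept \<le> 1/3"
      by linarith
    then show ?thesis using run[OF P] by simp
  qed
  define c where "c = real m * \<epsilon>\<^sup>2 / real k"
  have corr: "(\<Sum>x\<in>?X. u x * (L z x * L z' x)) ^ m \<le> exp (c * (\<Sum>i=1..k. z i * z' i))"
    if zz: "z \<in> ?Z" "z' \<in> ?Z" for z z'
  proof -
    let ?t = "\<epsilon>\<^sup>2 / real k * (\<Sum>i=1..k. z i * z' i)"
    have "(\<Sum>x\<in>?X. u x * (L z x * L z' x))
        = (\<Sum>x\<in>?X. u x * L z x + \<epsilon> / (2 * real k) * pair_sign k z' x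
            + \<epsilon>\<^sup>2 / (2 * real k) * (pair_sign k z x * pair_sign k z' x))"
      using k by (intro sum.cong refl) (simp add: u_def L_def field_simps power2_eq_square)
    also have "\<dots> = 1 + ?t"
      using k unfolding sum.distrib uL sum_distrib_left[symmetric] sum_pair_sign sum_pair_sign_mult
      by simp
    finally have eq: "(\<Sum>x\<in>?X. u x * (L z x * L z' x)) = 1 + ?t" .
    have "0 \<le> (\<Sum>x\<in>?X. u x * (L z x * L z' x))"
      using L0 zz by (intro sum_nonneg mult_nonneg_nonneg) (auto simp: u_def)
    then have "(1 + ?t) ^ m \<le> exp ?t ^ m"
      unfolding eq by (intro power_mono exp_ge_add_one_self)
    also have "exp ?t ^ m = exp (c * (\<Sum>i=1..k. z i * z' i))"
      by (simp add: c_def exp_of_nat_mult[symmetric])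
    finally show ?thesis unfolding eq .
  qed
  have "10/9 * (real (card ?Z))\<^sup>2 \<le> (\<Sum>z\<in>?Z. \<Sum>z'\<in>?Z. (\<Sum>x\<in>?X. u x * (L z x * L z' x)) ^ m)"
  proof (rule mixture_second_moment_lower_bound[OF finite_sign_vectors _ _ _ uL _ _ acc rej])
    show "?Z \<noteq> {}" using card_sign_vectors[of k] by fastforce
    show "(\<Sum>x\<in>?X. u x) = 1" using k by (simp add: u_def)
  qed (auto simp: u_def f_def pmf_le_1)
  also have "\<dots> \<le> (\<Sum>z\<in>?Z. \<Sum>z'\<in>?Z. exp (c * (\<Sum>i=1..k. z i * z' i)))"
    by (intro sum_mono corr)
  also have "\<dots> \<le> (\<Sum>z\<in>?Z. 2 ^ k * exp (c\<^sup>2 * k / 2))"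
    by (intro sum_mono sum_sign_vectors_exp) (auto simp: c_def)
  also have "\<dots> = (real (card ?Z))\<^sup>2 * exp (c\<^sup>2 * k / 2)"
    by (simp add: card_sign_vectors power2_eq_square)
  finally have ge: "10/9 \<le> exp (c\<^sup>2 * k / 2)"
    by (simp add: card_sign_vectors)
  have "1/10 \<le> c\<^sup>2 * k / 2"
  proof -
    have "exp (- (c\<^sup>2 * k / 2)) \<le> 9/10"
      using ge by (simp add: exp_minus field_simps)
    then show ?thesis using exp_ge_add_one_self[of "- (c\<^sup>2 * k / 2)"] by linarith
  qed
  then show ?thesis using k by (simp add: c_def power_divide power2_eq_square field_simps)
qed

text \<open>An even number of elements suffices for the construction, and leaves out at most a third of the
domain.\<close>

lemma testing_lower_bound:
  fixes n :: nat and \<epsilon> :: real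
  assumes n: "2 \<le> n" and eps: "0 < \<epsilon>" "\<epsilon> \<le> 1"
  shows "\<exists>q1 q2. dist_on n q1 \<and> dist_on n q2 \<and>
    (\<forall>m A. noise_identity_tester n q1 q2 \<epsilon> m A \<longrightarrow> 1/4 * sqrt (real n) / \<epsilon>\<^sup>2 \<le> real m)"
proof -
  define k where "k = n div 2"
  have k: "1 \<le> k" "2 * k \<le> n" "n \<le> 3 * k" using n by (auto simp: k_def)
  have "dist_on n (pmf_of_set {1..2*k})" using k by (auto simp: dist_on_def)
  moreover have "1/4 * sqrt (real n) / \<epsilon>\<^sup>2 \<le> real m"
    if "noise_identity_tester n (pmf_of_set {1..2*k}) (pmf_of_set {1..2*k}) \<epsilon> m A" for m A
  proof -
    have "(1/4 * sqrt (real n))\<^sup>2 \<le> (real m * \<epsilon>\<^sup>2)\<^sup>2"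
      using uniformity_lower_bound[OF k(1,2) eps that] k(3)
      by (simp add: power_mult_distrib power_divide)
    then have "1/4 * sqrt (real n) \<le> real m * \<epsilon>\<^sup>2"
      by (rule power2_le_imp_le) simp
    then show ?thesis using eps by (simp add: field_simps)
  qed
  ultimately show ?thesis by blast
qed

section \<open>Sample complexity of identity testing with known noise\<close>

theorem theorem3p1:
  shows
    "(\<exists>C>0. \<forall>(n::nat)\<ge>1. \<forall>\<epsilon>::real. \<forall>q1 q2.
        \<epsilon> > 0 \<longrightarrow> dist_on n q1 \<longrightarrow> dist_on n q2 \<longrightarrow>
        (\<exists>m A. real m \<le> C * sqrt (real n) / \<epsilon>\<^sup>2 \<and> noise_identity_tester n q1 q2 \<epsilon> m A))
   \<and> (\<exists>c>0. \<forall>(n::nat)\<ge>2. \<forall>\<epsilon>::real. 0 < \<epsilon> \<longrightarrow> \<epsilon> \<le> 1 \<longrightarrow>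
        (\<exists>q1 q2. dist_on n q1 \<and> dist_on n q2 \<and>
           (\<forall>m A. noise_identity_tester n q1 q2 \<epsilon> m A \<longrightarrow> real m \<ge> c * sqrt (real n) / \<epsilon>\<^sup>2)))"
proof (rule conjI, goal_cases)
  case 1
  show ?case
    by (intro exI[of _ "10^6 + 4 :: real"] conjI allI impI testing_upper_bound) simp_all
next
  case 2
  show ?case
    by (intro exI[of _ "1/4 :: real"] conjI allI impI testing_lower_bound) simp_all
qed

end
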